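(* Let $\phi\in\mathrm{Bir}(\mathbb{P}^2)$ be a birational self-map of the complex projective plane which preserves a rational fibration fibre by fibre. Then $\phi$ has linear growth if and only if the Baum-Bott index $\mathrm{BB}(\phi)$ belongs to $\mathbb{C}(y)\setminus\mathbb{C}$.
   Context: $\mathrm{Bir}(\mathbb{P}^2)$ (the Cremona group) is the group of birational self-maps of $\mathbb{P}^2(\mathbb{C})$. Each $\phi$ is written $(x:y:z)\dashrightarrow(\phi_0:\phi_1:\phi_2)$ with $\phi_i$ homogeneous polynomials of the same degree without common factor, and $\deg\phi$ is this common degree. $\phi$ has linear growth if $\deg\phi^n\sim n$, i.e. $\deg \phi^n$ grows like $n$: there are constants $0<c\le C$ with $cn\le\deg\phi^n\le Cn$ for all large $n$. A rational fibration is a pencil of rational curves on $\mathbb{P}^2(\mathbb{C})$, i.e. the level curves of a dominant rational map $f\colon\mathbb{P}^2\dashrightarrow\mathbb{P}^1$ whose generic fibre is an irreducible rational curve. $\phi$ preserves it if $f\circ\phi=h\circ f$ for some $h\in\mathrm{PGL}_2(\mathbb{C})$, and preserves it fibre by fibre if $f\circ\phi=f$. Any two rational fibrations are birationally conjugate, so one may conjugate to the fibration $y=\text{const}$ in an affine chart $(x,y)$. The elements preserving $y=\text{const}$ fibre by fibre form the group $\mathrm{J}_0\simeq\mathrm{PGL}_2(\mathbb{C}(y))$ of maps $$\phi=\left(\frac{A(y)x+B(y)}{C(y)x+D(y)},y\right),\qquad \mathrm{M}_\phi=\begin{bmatrix}A&B\\C&D\end{bmatrix}\in\mathrm{PGL}_2(\mathbb{C}[y]).$$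 The Baum-Bott index of $\phi\in\mathrm{J}_0$ is $\mathrm{BB}(\phi)=\frac{(\mathrm{tr}\,\mathrm{M}_\phi)^2}{\det\mathrm{M}_\phi}\in\mathbb{C}(y)$. For a $\phi$ preserving an arbitrary rational fibration fibre by fibre, $\mathrm{BB}(\phi)$ is the index of an element of $\mathrm{J}_0$ obtained by a birational conjugation sending the fibration to $y=\text{const}$ (well defined up to composition with a Möbius transformation in $y$). *)

theory Defs
  imports "HOL-Analysis.Analysis" "HOL-Computational_Algebra.Computational_Algebra"
    "HOL-Computational_Algebra.Field_as_Ring"
begin

text \<open>
  Polynomials in three variables \<open>x, y, z\<close> are nested univariate polynomials: \<open>y\<close> is the innermost
  variable, \<open>x\<close> the middle one and \<open>z\<close> the outermost one. Substituting \<open>z = 1\<close>, i.e. passing to the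
  affine chart \<open>(x : y : 1)\<close>, is then simply \<open>poly P 1\<close>, which is a polynomial in \<open>x\<close> with
  coefficients in \<open>\<complex>[y]\<close>.
\<close>

type_synonym poly3 = "complex poly poly poly"

definition const3 :: "complex \<Rightarrow> poly3"
  where "const3 c = [:[:[:c:]:]:]"

definition X :: poly3 where "X = [:[:0, 1:]:]"
definition Y :: poly3 where "Y = [:[:[:0, 1:]:]:]"
definition Z :: poly3 where "Z = [:0, 1:]"

definition homogeneous :: "nat \<Rightarrow> poly3 \<Rightarrow> bool"
  where "homogeneous d P \<longleftrightarrow>
    (\<forall>i j k. coeff (coeff (coeff P k) i) j \<noteq> 0 \<longrightarrow> i + j + k = d)"

text \<open>
  Value of \<open>P\<close> at \<open>v = (x, y, z)\<close> in a commutative \<open>\<complex>\<close>-algebra with structure map \<open>\<iota>\<close>; it is used for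
  points (\<open>\<iota> = id\<close>), for parametrised curves and for the composition of rational maps.
\<close>

definition eval3 :: "(complex \<Rightarrow> 'a::comm_ring_1) \<Rightarrow> poly3 \<Rightarrow> 'a^3 \<Rightarrow> 'a"
  where "eval3 \<iota> P v =
    poly (map_poly (\<lambda>q. poly (map_poly (\<lambda>r. poly (map_poly \<iota> r) (v$2)) q) (v$1)) P) (v$3)"


text \<open>
  A rational map from the projective plane to the projective space with homogeneous coordinates
  indexed by \<open>'n\<close>. The last condition says that there is no common factor; it excludes the zero tuple.
  Tuples represent the same map iff they are projectively equal.
\<close>

definition rational_map :: "poly3^'n \<Rightarrow> bool"
  where "rational_map F \<longleftrightarrow>
    (\<exists>d. \<forall>i. homogeneous d (F$i)) \<and> (\<forall>g. (\<forall>i. g dvd F$i) \<longrightarrow> is_unit g)"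

definition proj_eq :: "'a::comm_ring_1^'n \<Rightarrow> 'a^'n \<Rightarrow> bool"
  where "proj_eq u v \<longleftrightarrow> u \<noteq> 0 \<and> v \<noteq> 0 \<and> (\<forall>i j. u$i * v$j = u$j * v$i)"

definition substitute :: "poly3^'n \<Rightarrow> poly3^3 \<Rightarrow> poly3^'n"
  where "substitute F \<phi> = (\<chi> i. eval3 const3 (F$i) \<phi>)"

definition reduce :: "poly3^'n \<Rightarrow> poly3^'n"
  where "reduce F = (\<chi> i. F$i div Gcd_fin (range (($) F)))"

definition compose :: "poly3^'n \<Rightarrow> poly3^3 \<Rightarrow> poly3^'n"
  where "compose F \<phi> = reduce (substitute F \<phi>)"

definition id_map :: "poly3^3"
  where "id_map = vector [X, Y, Z]"

definition mutually_inverse :: "poly3^3 \<Rightarrow> poly3^3 \<Rightarrow> bool"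
  where "mutually_inverse \<phi> \<psi> \<longleftrightarrow> rational_map \<phi> \<and> rational_map \<psi> \<and>
    proj_eq (compose \<phi> \<psi>) id_map \<and> proj_eq (compose \<psi> \<phi>) id_map"

definition Bir :: "(poly3^3) set"
  where "Bir = {\<phi>. \<exists>\<psi>. mutually_inverse \<phi> \<psi>}"

definition iterate :: "poly3^3 \<Rightarrow> nat \<Rightarrow> poly3^3"
  where "iterate \<phi> n = (compose \<phi> ^^ n) id_map"

definition map_degree :: "poly3^3 \<Rightarrow> nat"
  where "map_degree \<phi> = (THE d. \<forall>i. homogeneous d (\<phi>$i))"

definition linear_growth :: "poly3^3 \<Rightarrow> bool"
  where "linear_growth \<phi> \<longleftrightarrow> (\<exists>c C :: real. 0 < c \<and> c \<le> C \<and>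
    (\<forall>\<^sub>F n in sequentially.
      c * real n \<le> real (map_degree (iterate \<phi> n)) \<and>
      real (map_degree (iterate \<phi> n)) \<le> C * real n))"


text \<open>
  The plane curve \<open>P = 0\<close> is irreducible and birational to the projective line: \<open>t \<mapsto> p(t)\<close> is a
  parametrisation and \<open>u/v\<close> a rational function on the curve with \<open>(u/v)(p(t)) = t\<close>. Then \<open>p\<close> is not
  constant, hence dominant onto the irreducible curve, so \<open>p \<circ> (u/v)\<close> is the identity of the curve.
\<close>

definition rational_curve :: "poly3 \<Rightarrow> bool"
  where "rational_curve P \<longleftrightarrow> irreducible P \<and>
    (\<exists>(p :: complex poly^3) u v e. homogeneous e u \<and> homogeneous e v \<and>
      eval3 (\<lambda>c. [:c:]) P p = 0 \<and>
      eval3 (\<lambda>c. [:c:]) v p \<noteq> 0 \<and>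
      eval3 (\<lambda>c. [:c:]) u p = [:0, 1:] * eval3 (\<lambda>c. [:c:]) v p)"

text \<open>
  Proper closed subsets of the projective line are finite, so dominant means infinite image.
\<close>

definition dominant :: "poly3^2 \<Rightarrow> bool"
  where "dominant f \<longleftrightarrow>
    infinite {c. \<exists>p. eval3 id (f$2) p \<noteq> 0 \<and> eval3 id (f$1) p = c * eval3 id (f$2) p}"

text \<open>
  ``Generic'' means for all but finitely many points of the projective line; the fibre over
  \<open>(c : 1)\<close> is \<open>f\<^sub>1 - c f\<^sub>2 = 0\<close>, and the single point \<open>(1 : 0)\<close> may be ignored.
\<close>

definition rational_fibration :: "poly3^2 \<Rightarrow> bool"
  where "rational_fibration f \<longleftrightarrow> rational_map f \<and> dominant f \<and>
    finite {c. \<not> rational_curve (f$1 - const3 c * f$2)}"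

definition preserves_fibrewise :: "poly3^3 \<Rightarrow> poly3^2 \<Rightarrow> bool"
  where "preserves_fibrewise \<phi> f \<longleftrightarrow> proj_eq (compose f \<phi>) f"

definition moebius :: "complex^2^2 \<Rightarrow> poly3^2 \<Rightarrow> poly3^2"
  where "moebius h f = (\<chi> i. \<Sum>j\<in>UNIV. const3 (h$i$j) * f$j)"

definition y_fibration :: "poly3^2"
  where "y_fibration = vector [Y, Z]"

text \<open>
  \<open>\<psi>\<close> maps the level curves of \<open>f\<close> to the lines \<open>y = const\<close>, up to a change of the parameter.
\<close>

definition straightens :: "poly3^3 \<Rightarrow> poly3^2 \<Rightarrow> bool"
  where "straightens \<psi> f \<longleftrightarrow>
    (\<exists>h. det h \<noteq> 0 \<and> proj_eq (compose y_fibration \<psi>) (moebius h f))"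

text \<open>
  In the chart \<open>z = 1\<close> the map \<open>\<phi>\<close> is \<open>((A(y) x + B(y)) / (C(y) x + D(y)), y)\<close>, where \<open>A, B, C, D\<close>
  are the entries of \<open>M\<close>. Below, \<open>[:B, A:]\<close> is \<open>A(y) x + B(y)\<close> and \<open>[:[:0, 1:]:]\<close> is \<open>y\<close>.
\<close>

definition jonquieres :: "poly3^3 \<Rightarrow> complex poly^2^2 \<Rightarrow> bool"
  where "jonquieres \<phi> M \<longleftrightarrow> det M \<noteq> 0 \<and>
    poly (\<phi>$1) 1 * [:M$2$2, M$2$1:] = poly (\<phi>$3) 1 * [:M$1$2, M$1$1:] \<and>
    poly (\<phi>$2) 1 = [:[:0, 1:]:] * poly (\<phi>$3) 1"

definition baum_bott :: "complex poly^2^2 \<Rightarrow> complex poly fract"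
  where "baum_bott M = Fract ((trace M)^2) (det M)"

text \<open>
  \<open>b\<close> is a value of the Baum-Bott index of \<open>\<phi>\<close>, which preserves \<open>f\<close> fibre by fibre. The index is only
  defined up to a Moebius substitution in \<open>y\<close>, hence a relation instead of a function.
\<close>

definition baum_bott_index :: "poly3^3 \<Rightarrow> poly3^2 \<Rightarrow> complex poly fract \<Rightarrow> bool"
  where "baum_bott_index \<phi> f b \<longleftrightarrow>
    (\<exists>\<psi> \<psi>' M. mutually_inverse \<psi> \<psi>' \<and> straightens \<psi> f \<and>
      jonquieres (compose \<psi> (compose \<phi> \<psi>')) M \<and> b = baum_bott M)"

definition constants :: "complex poly fract set"
  where "constants = range (\<lambda>c. to_fract [:c:])"

end

theory Submission
  imports Defs
begin

text \<open>
  Degree growth is a conjugacy invariant: \<open>deg (\<alpha> \<circ> \<beta>) \<le> deg \<alpha> * deg \<beta>\<close>, because among all homogeneous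
  triples that represent a map the one without common factor has the least degree
  (\<open>reduce_degree_minimal\<close>). If \<open>\<psi>\<close> carries the fibration to \<open>y = const\<close> and has the inverse \<open>\<psi>'\<close>, then
  \<open>\<psi> \<circ> \<phi> \<circ> \<psi>'\<close> is a Jonquieres map with some matrix \<open>M\<close>, and the conjugate of the \<open>n\<close>-th iterate of \<open>\<phi>\<close>
  is the Jonquieres map with matrix \<open>M\<^sup>n\<close> (\<open>conj_iterate_matpow\<close>). A matrix of polynomials in \<open>y\<close> of
  degree at most \<open>e\<close> gives a map of degree at most \<open>e + 2\<close>; conversely, a map of degree \<open>e\<close> is given by
  a matrix with entries of degree at most \<open>e\<close> (\<open>jonquieres_reduced_matrix\<close>). So everything depends
  on the least degree \<open>e\<^sub>n\<close> of the entries of a matrix proportional to \<open>M\<^sup>n\<close>.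

  The index \<open>tr\<^sup>2 / det\<close> is the same for proportional matrices. If \<open>r\<close> is the quotient of the
  eigenvalues of \<open>M\<close>, then \<open>M\<close> has index \<open>b = r + 1 / r + 2\<close> and \<open>M\<^sup>n\<close> has index \<open>r\<^sup>n + 1 / r\<^sup>n + 2\<close>, which
  for \<open>n > 0\<close> is a monic polynomial of degree \<open>n\<close> in \<open>b\<close>. When \<open>b\<close> is not constant, this is a rational function of
  \<open>y\<close> of degree at least \<open>n\<close>, whereas the index of a matrix with entries of degree at most \<open>e\<close> has
  degree at most \<open>2 * e\<close>. Hence \<open>n \<le> 2 * e\<^sub>n\<close> (\<open>degree_ge_if_index_nonconstant\<close>), and \<open>e\<^sub>n\<close> is at
  most \<open>n\<close> times the degree of the entries of \<open>M\<close>, so the growth is linear. When \<open>b\<close> is constant, the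
  theorem of Cayley and Hamilton shows that \<open>M\<^sup>n\<close> is proportional to a combination of \<open>M\<close> and \<open>tr M\<close>
  times the identity with \<^emph>\<open>complex\<close> coefficients, or to \<open>M\<close> or the identity if the trace vanishes.
  Then \<open>e\<^sub>n\<close> is bounded (\<open>bounded_if_index_constant\<close>), and so is the degree of the iterates.
\<close>

(* Power series use the same infix symbol as vectors for their components. *)
unbundle no Formal_Power_Series.fps_syntax

section \<open>Polynomials in three variables and their grading\<close>

definition ring_homo :: "('a::comm_ring_1 \<Rightarrow> 'b::comm_ring_1) \<Rightarrow> bool"
  where "ring_homo h \<longleftrightarrow> h 0 = 0 \<and> h 1 = 1 \<and>
    (\<forall>x y. h (x + y) = h x + h y) \<and> (\<forall>x y. h (x * y) = h x * h y)"

lemma ring_homoD: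
  assumes "ring_homo h"
  shows "h 0 = 0" "h 1 = 1" "h (x + y) = h x + h y" "h (x * y) = h x * h y"
  using assms by (auto simp: ring_homo_def)

lemma ring_homo_sum: "ring_homo h \<Longrightarrow> h (sum g A) = (\<Sum>i\<in>A. h (g i))"
  by (induction A rule: infinite_finite_induct) (auto simp: ring_homoD)

lemma ring_homo_power: "ring_homo h \<Longrightarrow> h (x ^ n) = h x ^ n"
  by (induction n) (auto simp: ring_homoD)

lemma ring_homo_comp: "ring_homo g \<Longrightarrow> ring_homo h \<Longrightarrow> ring_homo (\<lambda>x. g (h x))"
  by (auto simp: ring_homo_def)

lemma ring_homo_id: "ring_homo (\<lambda>x. x)"
  by (simp add: ring_homo_def)

lemma ring_homo_const_poly: "ring_homo (\<lambda>c. [:c:])"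
  by (simp add: ring_homo_def one_pCons)

lemma ring_homo_poly: "ring_homo (\<lambda>p. poly p v)"
  by (simp add: ring_homo_def)

lemma ring_homo_eval:
  assumes h: "ring_homo h"
  shows "ring_homo (\<lambda>p. poly (map_poly h p) v)"
proof -
  note [simp] = ring_homoD[OF h] map_poly_pCons
  have add: "poly (map_poly h (p + q)) v = poly (map_poly h p) v + poly (map_poly h q) v" for p q
    by (induction p q rule: poly_induct2) (auto simp: algebra_simps)
  have smult: "poly (map_poly h (smult a q)) v = h a * poly (map_poly h q) v" for a q
    by (induction q) (auto simp: algebra_simps)
  have mult: "poly (map_poly h (p * q)) v = poly (map_poly h p) v * poly (map_poly h q) v" for p q
    by (induction p) (auto simp: algebra_simps add smult)
  show ?thesis
    by (auto simp: ring_homo_def add mult one_pCons)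
qed

lemma ring_homo_eqI:
  assumes h: "ring_homo h" and k: "ring_homo k"
    and "\<And>c. h [:c:] = k [:c:]" and "h [:0, 1:] = k [:0, 1:]"
  shows "h p = k p"
proof (induction p)
  case 0
  show ?case using h k by (simp add: ring_homoD)
next
  case (pCons a p)
  have "pCons a p = [:a:] + [:0, 1:] * p" by simp
  then show ?case using assms pCons.IH
    by (simp only: ring_homoD[OF h] ring_homoD[OF k])
qed

lemma ring_homo_eval3: "ring_homo \<iota> \<Longrightarrow> ring_homo (\<lambda>P. eval3 \<iota> P v)"
  unfolding eval3_def by (intro ring_homo_eval)

lemma ring_homo_const3: "ring_homo const3"
  unfolding const3_def
  by (intro ring_homo_comp[OF ring_homo_const_poly] ring_homo_const_poly)

lemma ring_homo_const3_poly: "ring_homo (\<lambda>c. [:const3 c:])"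
  by (intro ring_homo_comp[OF ring_homo_const_poly] ring_homo_const3)

lemma eval3_generators:
  assumes "ring_homo \<iota>"
  shows "eval3 \<iota> (const3 c) v = \<iota> c" "eval3 \<iota> X v = v $ 1"
    "eval3 \<iota> Y v = v $ 2" "eval3 \<iota> Z v = v $ 3"
  by (simp_all add: eval3_def const3_def X_def Y_def Z_def map_poly_pCons ring_homoD[OF assms]
      one_pCons)

text \<open>
  The ring \<open>\<complex>[x, y, z]\<close> is generated by its constants and the three coordinates. So two ways of
  substituting agree as soon as they agree there; this gives the associativity of composition, for
  instance.
\<close>

lemma poly3_homo_eqI:
  fixes h k :: "poly3 \<Rightarrow> 'a::comm_ring_1"
  assumes h: "ring_homo h" and k: "ring_homo k"
    and "\<And>c. h (const3 c) = k (const3 c)" "h X = k X" "h Y = k Y" "h Z = k Z"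
  shows "h P = k P"
proof (rule ring_homo_eqI[OF h k])
  note c1 = ring_homo_comp[OF _ ring_homo_const_poly]
  fix p :: "complex poly poly"
  show "h [:p:] = k [:p:]"
  proof (rule ring_homo_eqI[OF c1[OF h] c1[OF k]])
    fix q :: "complex poly"
    show "h [:[:q:]:] = k [:[:q:]:]"
      by (rule ring_homo_eqI[OF c1[OF c1[OF h]] c1[OF c1[OF k]]])
        (use assms in \<open>simp_all add: const3_def Y_def\<close>)
  qed (use assms in \<open>simp add: X_def\<close>)
qed (use assms in \<open>simp add: Z_def\<close>)

lemma poly_map_poly_eq_sum:
  fixes v :: "'b::comm_ring_1"
  assumes "h 0 = 0"
  shows "poly (map_poly h p) v = (\<Sum>i\<le>degree p. h (coeff p i) * v ^ i)"
proof -
  have "poly (map_poly h p) v = (\<Sum>i\<le>degree (map_poly h p). h (coeff p i) * v ^ i)"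
    unfolding poly_altdef by (simp add: coeff_map_poly[where f = h, OF assms])
  also have "\<dots> = (\<Sum>i\<le>degree p. h (coeff p i) * v ^ i)"
  proof (rule sum.mono_neutral_left)
    show "{..degree (map_poly h p)} \<subseteq> {..degree p}"
    proof -
      have "degree (map_poly h p) \<le> degree p"
        by (rule degree_le) (simp add: coeff_map_poly[where f = h, OF assms] coeff_eq_0 assms)
      then show ?thesis by auto
    qed
    have "h (coeff p i) = 0" if "i > degree (map_poly h p)" for i
      using coeff_eq_0[OF that] assms by (simp add: coeff_map_poly)
    then show "\<forall>i\<in>{..degree p} - {..degree (map_poly h p)}. h (coeff p i) * v ^ i = 0" by auto
  qed auto
  finally show ?thesis .
qed

abbreviation coeff3 :: "poly3 \<Rightarrow> nat \<Rightarrow> nat \<Rightarrow> nat \<Rightarrow> complex"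
  where "coeff3 P i j k \<equiv> coeff (coeff (coeff P k) i) j"

lemma eval3_expand:
  assumes "ring_homo \<iota>"
  shows "eval3 \<iota> P v = (\<Sum>k\<le>degree P. \<Sum>i\<le>degree (coeff P k). \<Sum>j\<le>degree (coeff (coeff P k) i).
    \<iota> (coeff3 P i j k) * (v$1 ^ i * v$2 ^ j * v$3 ^ k))"
  by (simp add: eval3_def poly_map_poly_eq_sum ring_homoD[OF assms] sum_distrib_left
      sum_distrib_right mult_ac)

lemma eval3_scale:
  assumes "ring_homo \<iota>" and "homogeneous d P"
  shows "eval3 \<iota> P (\<chi> i. a * v$i) = a ^ d * eval3 \<iota> P v"
proof -
  have "\<iota> (coeff3 P i j k) * ((a * v$1) ^ i * (a * v$2) ^ j * (a * v$3) ^ k) =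
    a ^ d * (\<iota> (coeff3 P i j k) * (v$1 ^ i * v$2 ^ j * v$3 ^ k))" for i j k
  proof (cases "coeff3 P i j k = 0")
    case True
    then show ?thesis using assms by (simp add: ring_homoD)
  next
    case False
    then have "d = i + j + k" using assms(2) by (auto simp: homogeneous_def)
    then show ?thesis by (simp add: power_mult_distrib power_add mult_ac)
  qed
  then show ?thesis
    by (simp add: eval3_expand[OF assms(1)] sum_distrib_left)
qed

text \<open>
  This is \<open>P(t x, t y, t z)\<close> as a polynomial in a new variable \<open>t\<close>. As \<open>P\<close> is homogeneous of degree \<open>d\<close>
  exactly if the result is \<open>P t\<^sup>d\<close>, homogeneity becomes an equation in a polynomial ring.
\<close>

definition graded :: "poly3 \<Rightarrow> poly3 poly"
  where "graded P = eval3 (\<lambda>c. [:const3 c:]) P (vector [monom X 1, monom Y 1, monom Z 1])"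

lemma ring_homo_graded: "ring_homo graded"
  unfolding graded_def by (intro ring_homo_eval3 ring_homo_const3_poly)

lemma graded_generators:
  "graded (const3 c) = [:const3 c:]" "graded X = monom X 1" "graded Y = monom Y 1"
  "graded Z = monom Z 1"
  by (simp_all add: graded_def eval3_generators[OF ring_homo_const3_poly] vector_3)

lemma poly_graded_1: "poly (graded P) 1 = P"
  by (rule poly3_homo_eqI[OF ring_homo_comp[OF ring_homo_poly ring_homo_graded] ring_homo_id])
    (simp_all add: graded_generators poly_monom)

lemma eval3_const_poly: "eval3 (\<lambda>c. [:const3 c:]) P (\<chi> i. [:\<phi>$i:]) = [:eval3 const3 P \<phi>:]"
  by (rule poly3_homo_eqI[OF ring_homo_eval3[OF ring_homo_const3_poly]
        ring_homo_comp[OF ring_homo_const_poly ring_homo_eval3[OF ring_homo_const3]]])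
    (simp_all add: eval3_generators[OF ring_homo_const3_poly] eval3_generators[OF ring_homo_const3])

lemma id_map_simps: "id_map $ 1 = X" "id_map $ 2 = Y" "id_map $ 3 = Z"
  by (simp_all add: id_map_def vector_3)

lemma eval3_id: "eval3 const3 P id_map = P"
  by (rule poly3_homo_eqI[OF ring_homo_eval3[OF ring_homo_const3] ring_homo_id])
    (simp_all add: eval3_generators[OF ring_homo_const3] id_map_simps)

lemma homogeneous_sum: "(\<And>i. i \<in> A \<Longrightarrow> homogeneous d (g i)) \<Longrightarrow> homogeneous d (sum g A)"
proof (induction A rule: infinite_finite_induct)
  case (insert a A)
  then have "homogeneous d (g a)" "homogeneous d (sum g A)" by auto
  then show ?case using insert.hyps unfolding homogeneous_def
    by (auto simp: coeff_add) (metis add_0)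
qed (simp_all add: homogeneous_def)

lemma monomial_eq: "const3 c * (X ^ i * Y ^ j * Z ^ k) = monom (monom (monom c j) i) k"
proof -
  have *: "[:0, 1::'b::comm_ring_1:] ^ n = monom 1 n" for n
    by (simp add: monom_altdef)
  have "Z ^ k = monom 1 k" "X ^ i = [:monom 1 i:]" "Y ^ j = [:[:monom 1 j:]:]"
    by (simp_all add: X_def Y_def Z_def * ring_homo_power[OF ring_homo_const_poly, symmetric])
  then show ?thesis
    by (simp add: const3_def smult_monom)
qed

lemma homogeneous_monomial: "homogeneous (i + j + k) (const3 c * (X ^ i * Y ^ j * Z ^ k))"
  by (auto simp: monomial_eq homogeneous_def coeff_monom split: if_splits)

lemma homogeneous_coeff_graded: "homogeneous n (coeff (graded P) n)"
proof -
  have 1: "[:const3 c:] * (monom X 1 ^ i * monom Y 1 ^ j * monom Z 1 ^ k) =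
    monom (const3 c * (X ^ i * Y ^ j * Z ^ k)) (i + j + k)" for c i j k
    by (simp add: monom_power mult_monom smult_monom)
  have 2: "homogeneous n (coeff (monom (const3 c * (X ^ i * Y ^ j * Z ^ k)) (i + j + k)) n)" for c i j k
    using homogeneous_monomial[of i j k c] by (auto simp: coeff_monom) (simp add: homogeneous_def)
  show ?thesis
    unfolding graded_def eval3_expand[OF ring_homo_const3_poly] vector_3 coeff_sum 1
    by (intro homogeneous_sum 2)
qed

lemma eval3_monom:
  assumes "homogeneous d P"
  shows "eval3 (\<lambda>c. [:const3 c:]) P (\<chi> i. monom (\<phi>$i) e) = monom (eval3 const3 P \<phi>) (d * e)"
proof -
  have "(\<chi> i. monom (\<phi>$i) e) = (\<chi> i. monom 1 e * (\<chi> i. [:\<phi>$i:])$i)"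
    by (simp add: mult_monom smult_monom)
  then show ?thesis
    by (simp only: eval3_scale[OF ring_homo_const3_poly assms] eval3_const_poly)
      (simp add: monom_power smult_monom mult.commute)
qed

lemma homogeneous_iff_graded: "homogeneous d P \<longleftrightarrow> graded P = monom P d"
proof
  assume "homogeneous d P"
  have "vector [monom X 1, monom Y 1, monom Z 1] = (\<chi> i. monom (id_map$i) 1)"
    by (simp add: vec_eq_iff forall_3 vector_3 id_map_simps)
  then show "graded P = monom P d"
    by (simp only: graded_def eval3_monom[OF \<open>homogeneous d P\<close>]) (simp add: eval3_id)
next
  assume "graded P = monom P d"
  then show "homogeneous d P"
    using homogeneous_coeff_graded[of d P] by simp
qed

lemma homogeneous_add: "homogeneous d P \<Longrightarrow> homogeneous d Q \<Longrightarrow> homogeneous d (P + Q)"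
  by (simp add: homogeneous_iff_graded ring_homoD[OF ring_homo_graded] add_monom)

lemma homogeneous_mult: "homogeneous d P \<Longrightarrow> homogeneous e Q \<Longrightarrow> homogeneous (d + e) (P * Q)"
  by (simp add: homogeneous_iff_graded ring_homoD[OF ring_homo_graded] mult_monom)

lemma homogeneous_generators: "homogeneous 1 X" "homogeneous 1 Y" "homogeneous 1 Z"
  by (simp_all add: homogeneous_iff_graded graded_generators)

lemma homogeneous_unique: "homogeneous d P \<Longrightarrow> homogeneous e P \<Longrightarrow> P \<noteq> 0 \<Longrightarrow> d = e"
  by (metis homogeneous_iff_graded degree_monom_eq)

text \<open>
  The order of vanishing at \<open>0\<close> and the degree are both additive on products, and the former never
  exceeds the latter. They agree for a monomial, hence also for each of its factors.
\<close>

lemma factor_of_monom: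
  fixes A B :: "'a::idom poly"
  assumes "A * B = monom c d" "c \<noteq> 0"
  shows "\<exists>a e. e \<le> d \<and> A = monom a e"
proof -
  have nz: "A * B \<noteq> 0" "A \<noteq> 0" "B \<noteq> 0" using assms by (auto simp: monom_eq_0_iff)
  have "order 0 A + order 0 B = d"
    using assms order_mult[OF nz(1), of 0] by (simp add: order_0_monom)
  moreover have deg: "degree A + degree B = d"
    using assms degree_mult_eq[OF nz(2,3)] by (simp add: degree_monom_eq)
  ultimately have "order 0 A = degree A"
    using order_degree[OF nz(2), of 0] order_degree[OF nz(3), of 0] by linarith
  then have "monom 1 (degree A) dvd A"
    using order_1[of 0 A] by (simp add: monom_altdef)
  then obtain q where q: "A = monom 1 (degree A) * q" by auto
  with nz have "q \<noteq> 0" by auto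
  then have "degree A = degree A + degree q"
    using arg_cong[OF q, of degree] degree_mult_eq[of "monom 1 (degree A)" q]
    by (simp add: degree_monom_eq monom_eq_0_iff)
  then obtain a where "q = [:a:]" by (metis add_cancel_right_right degree_eq_zeroE)
  with q have "A = monom a (degree A)"
    by (metis mult.commute mult.right_neutral mult_monom add_0 monom_0 mult_1)
  with deg show ?thesis by (metis le_add1)
qed

text \<open>
  Dividing a homogeneous tuple by its greatest common divisor therefore leaves a homogeneous tuple,
  so that the degree of the reduced composition is meaningful.
\<close>

lemma homogeneous_factor:
  assumes "homogeneous d (P * Q)" "P * Q \<noteq> 0"
  shows "\<exists>e\<le>d. homogeneous e P"
proof -
  have "graded P * graded Q = monom (P * Q) d"
    using assms(1) by (simp add: homogeneous_iff_graded ring_homoD[OF ring_homo_graded])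
  from factor_of_monom[OF this assms(2)] obtain a e where "e \<le> d" "graded P = monom a e" by auto
  moreover from this have "a = P" using poly_graded_1[of P] by (simp add: poly_monom)
  ultimately show ?thesis by (auto simp: homogeneous_iff_graded)
qed

text \<open>
  Once the total degree is fixed, the exponents of \<open>x\<close> and \<open>y\<close> determine that of \<open>z\<close>, so no terms are
  merged by \<open>z = 1\<close>. Identities can thus be checked in the affine chart.
\<close>

lemma homogeneous_dehomogenise_inj:
  assumes P: "homogeneous d P" and Q: "homogeneous d Q" and eq: "poly P 1 = poly Q 1"
  shows "P = Q"
proof (rule poly_eqI, rule poly_eqI, rule poly_eqI)
  fix k i j
  have *: "coeff (coeff (poly R 1) i) j = coeff3 R i j k"
    if R: "homogeneous d R" and d: "i + j + k = d" for R
  proof -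
    have "coeff3 R i j l = 0" if "l \<noteq> k" for l
      using R d that unfolding homogeneous_def by (metis add_left_cancel)
    then have "(\<Sum>l\<le>degree R. coeff3 R i j l) = (\<Sum>l\<in>{k} \<inter> {..degree R}. coeff3 R i j l)"
      by (intro sum.mono_neutral_right) auto
    also have "\<dots> = coeff3 R i j k"
      by (cases "k \<le> degree R") (auto simp: coeff_eq_0)
    finally show ?thesis
      by (simp add: poly_altdef coeff_sum)
  qed
  show "coeff3 P i j k = coeff3 Q i j k"
  proof (cases "i + j + k = d")
    case True
    then show ?thesis using *[OF P True] *[OF Q True] eq by simp
  next
    case False
    then show ?thesis using P Q unfolding homogeneous_def by metis
  qed
qed

section \<open>Composition and degrees of rational maps\<close>

lemma eval3_substitute:
  "eval3 const3 (eval3 const3 P \<phi>) \<psi> = eval3 const3 P (substitute \<phi> \<psi>)"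
  by (rule poly3_homo_eqI[OF
        ring_homo_comp[OF ring_homo_eval3[OF ring_homo_const3] ring_homo_eval3[OF ring_homo_const3]]
        ring_homo_eval3[OF ring_homo_const3]])
    (simp_all add: eval3_generators[OF ring_homo_const3] substitute_def)

lemma substitute_assoc:
  "substitute (substitute F \<phi>) \<psi> = substitute F (substitute \<phi> \<psi>)"
  by (simp add: vec_eq_iff eval3_substitute) (simp add: substitute_def eval3_substitute)

lemma substitute_id_left: "substitute id_map \<phi> = \<phi>"
  by (simp add: vec_eq_iff forall_3 substitute_def id_map_simps eval3_generators[OF ring_homo_const3])

lemma substitute_id_right: "substitute F id_map = F"
  by (simp add: vec_eq_iff substitute_def eval3_id)

lemma homogeneous_eval3:
  fixes \<phi> :: "poly3^3"
  assumes P: "homogeneous d P" and \<phi>: "\<And>i. homogeneous e (\<phi>$i)"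
  shows "homogeneous (d * e) (eval3 const3 P \<phi>)"
proof -
  have "graded (eval3 const3 P \<phi>) = eval3 (\<lambda>c. [:const3 c:]) P (\<chi> i. graded (\<phi>$i))"
    by (rule poly3_homo_eqI[OF
        ring_homo_comp[OF ring_homo_graded ring_homo_eval3[OF ring_homo_const3]]
        ring_homo_eval3[OF ring_homo_const3_poly]])
      (simp_all add: eval3_generators[OF ring_homo_const3] eval3_generators[OF ring_homo_const3_poly]
        graded_generators)
  also have "(\<chi> i. graded (\<phi>$i)) = (\<chi> i. monom (\<phi>$i) e)"
    using \<phi> by (simp add: homogeneous_iff_graded)
  finally show ?thesis
    by (simp add: homogeneous_iff_graded eval3_monom[OF P])
qed

definition homogeneous_tuple :: "nat \<Rightarrow> poly3^'n \<Rightarrow> bool"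
  where "homogeneous_tuple d F \<longleftrightarrow> (\<forall>i. homogeneous d (F$i))"

lemma homogeneous_tuple_substitute:
  "homogeneous_tuple d F \<Longrightarrow> homogeneous_tuple e \<phi> \<Longrightarrow> homogeneous_tuple (d * e) (substitute F \<phi>)"
  by (simp add: homogeneous_tuple_def substitute_def homogeneous_eval3)

lemma homogeneous_tuple_id: "homogeneous_tuple 1 id_map"
  using homogeneous_generators by (simp add: homogeneous_tuple_def forall_3 id_map_simps)

lemma proj_eqD:
  fixes u v :: "poly3^'n"
  assumes "proj_eq u v"
  obtains i where "u$i \<noteq> 0" "v$i \<noteq> 0" "\<And>j. v$i * u$j = u$i * v$j"
proof -
  from assms obtain i where i: "u$i \<noteq> 0" by (auto simp: proj_eq_def vec_eq_iff)
  have eq: "u$i * v$j = u$j * v$i" for j using assms by (auto simp: proj_eq_def)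
  have "v$i \<noteq> 0"
  proof
    assume "v$i = 0"
    then have "v$j = 0" for j using eq[of j] i by simp
    then show False using assms by (auto simp: proj_eq_def vec_eq_iff)
  qed
  with i eq show thesis by (intro that[of i]) (auto simp: mult.commute)
qed

lemma proj_eqI:
  fixes u v :: "poly3^'n"
  assumes "u \<noteq> 0" "a \<noteq> 0" "b \<noteq> 0" "\<And>i. a * u$i = b * v$i"
  shows "proj_eq u v"
proof -
  have "v \<noteq> 0"
  proof
    assume "v = 0"
    then have "u$i = 0" for i using assms(2) assms(4)[of i] by simp
    then show False using assms(1) by (auto simp: vec_eq_iff)
  qed
  moreover have "u$i * v$j = u$j * v$i" for i j
  proof -
    have "(a * b) * (u$i * v$j) = (a * u$i) * (b * v$j)" by (simp add: mult_ac)
    also have "\<dots> = (b * v$i) * (a * u$j)" by (simp add: assms(4))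
    also have "\<dots> = (a * b) * (u$j * v$i)" by (simp add: mult_ac)
    finally show ?thesis using assms(2,3) by simp
  qed
  ultimately show ?thesis using assms(1) by (simp add: proj_eq_def)
qed

lemma proj_eq_refl: "u \<noteq> 0 \<Longrightarrow> proj_eq u (u :: poly3^'n)"
  by (simp add: proj_eq_def mult.commute)

lemma proj_eq_sym: "proj_eq u v \<Longrightarrow> proj_eq v (u :: poly3^'n)"
  by (auto simp: proj_eq_def mult.commute)

lemma proj_eq_trans [trans]:
  fixes u v w :: "poly3^'n"
  assumes "proj_eq u v" "proj_eq v w"
  shows "proj_eq u w"
proof -
  obtain i where i: "u$i \<noteq> 0" "v$i \<noteq> 0" "\<And>j. v$i * u$j = u$i * v$j"
    by (rule proj_eqD[OF assms(1)]) blast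
  obtain l where l: "v$l \<noteq> 0" "w$l \<noteq> 0" "\<And>j. w$l * v$j = v$l * w$j"
    by (rule proj_eqD[OF assms(2)]) blast
  show ?thesis
  proof (rule proj_eqI[of _ "w$l * v$i" "u$i * v$l"])
    show "u \<noteq> 0" using i(1) by auto
    show "w$l * v$i \<noteq> 0" "u$i * v$l \<noteq> 0" using i(1,2) l(1,2) by auto
    fix j
    have "w$l * v$i * u$j = w$l * (v$i * u$j)" by (simp only: mult.assoc)
    also have "\<dots> = u$i * (w$l * v$j)" by (simp only: i(3) mult.left_commute)
    finally show "w$l * v$i * u$j = u$i * v$l * w$j" by (simp only: l(3) mult.assoc)
  qed
qed

text \<open>
  Injectivity of the substitution on homogeneous polynomials says that no curve contains the image,
  i.e. that the map is dominant. This keeps compositions from vanishing identically.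
\<close>

definition dominant_self_map :: "poly3^3 \<Rightarrow> bool"
  where "dominant_self_map \<phi> \<longleftrightarrow> (\<exists>d. homogeneous_tuple d \<phi>) \<and>
    (\<forall>d P. homogeneous d P \<longrightarrow> eval3 const3 P \<phi> = 0 \<longrightarrow> P = 0)"

lemma dominant_self_map_nonzero:
  assumes "dominant_self_map \<phi>"
  shows "\<phi> \<noteq> 0"
proof
  assume "\<phi> = 0"
  then have "eval3 const3 X \<phi> = 0"
    by (simp add: eval3_generators[OF ring_homo_const3])
  then have "X = 0" using assms homogeneous_generators(1) by (auto simp: dominant_self_map_def)
  then show False by (simp add: X_def)
qed

lemma substitute_nonzero:
  assumes "F \<noteq> 0" "homogeneous_tuple d F" "dominant_self_map \<phi>"
  shows "substitute F \<phi> \<noteq> 0"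
proof -
  from assms(1) obtain i where "F$i \<noteq> 0" by (auto simp: vec_eq_iff)
  then have "eval3 const3 (F$i) \<phi> \<noteq> 0"
    using assms(2,3) by (auto simp: dominant_self_map_def homogeneous_tuple_def)
  then show ?thesis by (auto simp: vec_eq_iff substitute_def)
qed

lemma dominant_self_map_substitute:
  assumes "dominant_self_map \<phi>" "dominant_self_map \<psi>"
  shows "dominant_self_map (substitute \<phi> \<psi>)"
proof -
  obtain d e where d: "homogeneous_tuple d \<phi>" and e: "homogeneous_tuple e \<psi>"
    using assms by (auto simp: dominant_self_map_def)
  have "P = 0" if "homogeneous n P" "eval3 const3 P (substitute \<phi> \<psi>) = 0" for n P
    using that assms homogeneous_eval3[OF that(1)] d
    unfolding eval3_substitute[symmetric] dominant_self_map_def homogeneous_tuple_def by blast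
  then show ?thesis
    using homogeneous_tuple_substitute[OF d e] by (auto simp: dominant_self_map_def)
qed

lemma eval3_proj_eq:
  assumes "proj_eq \<phi> \<psi>"
  shows "\<exists>a b. a \<noteq> 0 \<and> b \<noteq> 0 \<and>
    (\<forall>P. homogeneous d P \<longrightarrow> a * eval3 const3 P \<phi> = b * eval3 const3 P \<psi>)"
proof -
  obtain i where i: "\<phi>$i \<noteq> 0" "\<psi>$i \<noteq> 0" "\<And>j. \<psi>$i * \<phi>$j = \<phi>$i * \<psi>$j"
    by (rule proj_eqD[OF assms(1)]) blast
  have eq: "(\<chi> j. \<psi>$i * \<phi>$j) = (\<chi> j. \<phi>$i * \<psi>$j)" by (simp only: i(3))
  have "(\<psi>$i) ^ d * eval3 const3 P \<phi> = (\<phi>$i) ^ d * eval3 const3 P \<psi>"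
    if "homogeneous d P" for P
    unfolding eval3_scale[OF ring_homo_const3 that, symmetric] eq ..
  moreover have "(\<psi>$i) ^ d \<noteq> 0" "(\<phi>$i) ^ d \<noteq> 0" using i(1,2) by auto
  ultimately show ?thesis by blast
qed

lemma dominant_self_map_proj_eq:
  assumes "proj_eq \<phi> \<psi>" "dominant_self_map \<phi>" "homogeneous_tuple e \<psi>"
  shows "dominant_self_map \<psi>"
proof -
  have "P = 0" if P: "homogeneous n P" "eval3 const3 P \<psi> = 0" for n P
  proof -
    obtain a b where "a \<noteq> 0" "a * eval3 const3 P \<phi> = b * eval3 const3 P \<psi>"
      using eval3_proj_eq[OF assms(1), of n] P(1) by auto
    then have "eval3 const3 P \<phi> = 0" using P(2) by simp
    then show ?thesis using assms(2) P(1) by (auto simp: dominant_self_map_def)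
  qed
  then show ?thesis using assms(3) by (auto simp: dominant_self_map_def)
qed

lemma dominant_self_map_id: "dominant_self_map id_map"
  using homogeneous_tuple_id by (auto simp: dominant_self_map_def eval3_id)

lemma proj_eq_substitute_right:
  assumes "proj_eq \<phi> \<psi>" "F \<noteq> 0" "homogeneous_tuple d F" "dominant_self_map \<phi>"
  shows "proj_eq (substitute F \<phi>) (substitute F \<psi>)"
proof -
  obtain a b where ab: "a \<noteq> 0" "b \<noteq> 0"
    "\<And>P. homogeneous d P \<Longrightarrow> a * eval3 const3 P \<phi> = b * eval3 const3 P \<psi>"
    using eval3_proj_eq[OF assms(1), of d] by auto
  show ?thesis
    using ab(3) assms(3)
    by (intro proj_eqI[OF substitute_nonzero[OF assms(2-4)] ab(1,2)])
      (simp add: substitute_def homogeneous_tuple_def)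
qed

lemma proj_eq_substitute_left:
  assumes "proj_eq F G" "homogeneous_tuple d F" "homogeneous_tuple e G" "dominant_self_map \<phi>"
  shows "proj_eq (substitute F \<phi>) (substitute G \<phi>)"
proof -
  have nz: "F \<noteq> 0" "G \<noteq> 0" using assms(1) by (auto simp: proj_eq_def)
  have "eval3 const3 (F$i) \<phi> * eval3 const3 (G$j) \<phi> = eval3 const3 (F$j) \<phi> * eval3 const3 (G$i) \<phi>" for i j
    using assms(1) by (simp add: proj_eq_def ring_homoD(4)[OF ring_homo_eval3[OF ring_homo_const3], symmetric])
  then show ?thesis
    using substitute_nonzero[OF nz(1) assms(2,4)] substitute_nonzero[OF nz(2) assms(3,4)]
    by (simp add: proj_eq_def substitute_def)
qed

lemma dominant_self_mapE:
  assumes "dominant_self_map \<phi>"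
  obtains d where "homogeneous_tuple d \<phi>"
  using assms by (auto simp: dominant_self_map_def)

lemma proj_eq_substitute:
  assumes "proj_eq F G" "dominant_self_map F" "dominant_self_map G"
    and "proj_eq \<phi> \<psi>" "dominant_self_map \<phi>"
  shows "proj_eq (substitute F \<phi>) (substitute G \<psi>)"
proof -
  obtain d e where d: "homogeneous_tuple d F" and e: "homogeneous_tuple e G"
    using assms(2,3) by (auto simp: dominant_self_map_def)
  have "proj_eq (substitute F \<phi>) (substitute G \<phi>)"
    by (rule proj_eq_substitute_left[OF assms(1) d e assms(5)])
  also have "proj_eq (substitute G \<phi>) (substitute G \<psi>)"
    by (rule proj_eq_substitute_right[OF assms(4) dominant_self_map_nonzero[OF assms(3)] e assms(5)])
  finally show ?thesis .
qed

lemma reduce_factor: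
  fixes F :: "poly3^'n"
  shows "F$i = Gcd_fin (range (($) F)) * reduce F$i"
  by (simp only: reduce_def vec_lambda_beta dvd_mult_div_cancel[OF Gcd_fin_dvd] rangeI)

lemma Gcd_fin_range_nonzero:
  fixes F :: "poly3^'n"
  assumes "F \<noteq> 0"
  shows "Gcd_fin (range (($) F)) \<noteq> 0"
proof
  assume "Gcd_fin (range (($) F)) = 0"
  then have "F$i = 0" for i using reduce_factor[of F i] by simp
  then show False using assms by (simp add: vec_eq_iff)
qed

lemma proj_eq_reduce:
  fixes F :: "poly3^'n"
  assumes "F \<noteq> 0"
  shows "proj_eq F (reduce F)"
  by (rule proj_eqI[OF assms, of 1 "Gcd_fin (range (($) F))"])
    (simp_all only: Gcd_fin_range_nonzero[OF assms] mult_1 reduce_factor[symmetric] one_neq_zero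
      not_False_eq_True)

lemma unit_if_dvd_reduce:
  fixes F :: "poly3^'n"
  assumes "F \<noteq> 0" "\<And>i. g dvd reduce F$i"
  shows "is_unit g"
proof -
  let ?D = "Gcd_fin (range (($) F))"
  have "?D * g dvd F$i" for i
    by (subst reduce_factor) (rule mult_dvd_mono[OF dvd_refl assms(2)])
  then have "?D * g dvd ?D" by (intro Gcd_fin_greatest) auto
  then show ?thesis using Gcd_fin_range_nonzero[OF assms(1)] by (metis dvd_mult_cancel_left mult.right_neutral)
qed

lemma homogeneous_tuple_reduce:
  fixes F :: "poly3^'n"
  assumes F: "homogeneous_tuple d F" and nz: "F \<noteq> 0"
  shows "\<exists>e. homogeneous_tuple e (reduce F)"
proof -
  let ?D = "Gcd_fin (range (($) F))"
  from nz obtain i where i: "F$i \<noteq> 0" by (auto simp: vec_eq_iff)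
  have "homogeneous d (?D * reduce F$i)" "?D * reduce F$i \<noteq> 0"
    using F i unfolding reduce_factor[symmetric] by (auto simp: homogeneous_tuple_def)
  then obtain k where k: "homogeneous k ?D" "k \<le> d" using homogeneous_factor by blast
  have "homogeneous (d - k) (reduce F$j)" for j
  proof (cases "F$j = 0")
    case True
    then have "reduce F$j = 0"
      using reduce_factor[of F j] Gcd_fin_range_nonzero[OF nz] by simp
    then show ?thesis by (simp add: homogeneous_def)
  next
    case False
    have h: "homogeneous d (reduce F$j * ?D)" "reduce F$j * ?D \<noteq> 0"
      using F False unfolding mult.commute[of _ ?D] reduce_factor[symmetric]
      by (auto simp: homogeneous_tuple_def)
    then obtain l where l: "homogeneous l (reduce F$j)" using homogeneous_factor by blast
    have "l + k = d" by (rule homogeneous_unique[OF homogeneous_mult[OF l k(1)] h])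
    then show ?thesis using l by auto
  qed
  then show ?thesis by (auto simp: homogeneous_tuple_def)
qed

text \<open>
  A relation \<open>a * reduce F = b * G\<close> may be divided by a common factor until \<open>a\<close> and \<open>b\<close> are coprime. Then
  \<open>b\<close> divides all entries of \<open>reduce F\<close>, hence is a unit, and \<open>G\<close> is a polynomial multiple of
  \<open>reduce F\<close>.
\<close>

lemma reduce_degree_minimal:
  fixes F G :: "poly3^'n"
  assumes nz: "F \<noteq> 0" and eq: "proj_eq F G"
    and d: "homogeneous_tuple d (reduce F)" and e: "homogeneous_tuple e G"
  shows "d \<le> e"
proof -
  have "proj_eq (reduce F) G" by (rule proj_eq_trans[OF proj_eq_sym[OF proj_eq_reduce[OF nz]] eq])
  then obtain i where i: "reduce F$i \<noteq> 0" "G$i \<noteq> 0" "\<And>j. G$i * reduce F$j = reduce F$i * G$j"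
    by (rule proj_eqD) blast
  obtain a b where ab: "coprime a b" "G$i = a * gcd (G$i) (reduce F$i)"
    "reduce F$i = b * gcd (G$i) (reduce F$i)"
    using gcd_coprime_exists[of "G$i" "reduce F$i"] i(1) by (metis gcd_eq_0_iff)
  have "b dvd reduce F$j" for j
  proof -
    have "gcd (G$i) (reduce F$i) * (a * reduce F$j) = (a * gcd (G$i) (reduce F$i)) * reduce F$j"
      by (simp only: mult_ac)
    also have "\<dots> = (b * gcd (G$i) (reduce F$i)) * G$j"
      by (simp only: i(3) ab(2,3)[symmetric])
    finally have "gcd (G$i) (reduce F$i) * (a * reduce F$j) = gcd (G$i) (reduce F$i) * (b * G$j)"
      by (simp only: mult_ac)
    then have "a * reduce F$j = b * G$j" using i(1) by simp
    then have "b dvd a * reduce F$j" by simp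
    then show ?thesis using ab(1) by (simp add: coprime_commute coprime_dvd_mult_right_iff)
  qed
  then have "is_unit b" by (rule unit_if_dvd_reduce[OF nz])
  then have "reduce F$i dvd G$i"
    by (metis ab(2,3) dvd_triv_right mult_unit_dvd_iff')
  then obtain c where "G$i = reduce F$i * c" by auto
  moreover have "homogeneous e (G$i)" using e by (simp add: homogeneous_tuple_def)
  ultimately have "homogeneous e (reduce F$i * c)" "reduce F$i * c \<noteq> 0"
    using i(2) by metis+
  then obtain l where "l \<le> e" "homogeneous l (reduce F$i)" using homogeneous_factor by blast
  then show ?thesis using d i(1) homogeneous_unique by (metis homogeneous_tuple_def)
qed

lemma map_degree_eq:
  assumes "homogeneous_tuple d \<phi>" "\<phi> \<noteq> 0"
  shows "map_degree \<phi> = d"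
  unfolding map_degree_def
proof (rule the_equality)
  show "\<forall>i. homogeneous d (\<phi>$i)" using assms by (simp add: homogeneous_tuple_def)
  fix e assume "\<forall>i. homogeneous e (\<phi>$i)"
  moreover obtain i where "\<phi>$i \<noteq> 0" using assms(2) by (auto simp: vec_eq_iff)
  ultimately show "e = d" using assms(1) homogeneous_unique unfolding homogeneous_tuple_def by blast
qed

lemma homogeneous_map_degree: "dominant_self_map \<phi> \<Longrightarrow> homogeneous_tuple (map_degree \<phi>) \<phi>"
  using map_degree_eq dominant_self_map_nonzero by (metis dominant_self_mapE)

lemma compose_dominant:
  assumes "dominant_self_map \<phi>" "dominant_self_map \<psi>"
  shows "dominant_self_map (compose \<phi> \<psi>)" "proj_eq (compose \<phi> \<psi>) (substitute \<phi> \<psi>)"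
proof -
  have dom: "dominant_self_map (substitute \<phi> \<psi>)"
    by (rule dominant_self_map_substitute[OF assms])
  note nz = dominant_self_map_nonzero[OF dom]
  show eq: "proj_eq (compose \<phi> \<psi>) (substitute \<phi> \<psi>)"
    unfolding compose_def by (rule proj_eq_sym[OF proj_eq_reduce[OF nz]])
  obtain d where "homogeneous_tuple d (substitute \<phi> \<psi>)" using dom by (rule dominant_self_mapE)
  then obtain e where "homogeneous_tuple e (compose \<phi> \<psi>)"
    unfolding compose_def using homogeneous_tuple_reduce nz by blast
  then show "dominant_self_map (compose \<phi> \<psi>)"
    by (rule dominant_self_map_proj_eq[OF proj_eq_sym[OF eq] dom])
qed

lemma map_degree_compose_le:
  assumes "dominant_self_map \<phi>" "dominant_self_map \<psi>"
    and "proj_eq (compose \<phi> \<psi>) G" "homogeneous_tuple e G"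
  shows "map_degree (compose \<phi> \<psi>) \<le> e"
proof -
  note nz = dominant_self_map_nonzero[OF dominant_self_map_substitute[OF assms(1,2)]]
  obtain d where d: "homogeneous_tuple d (compose \<phi> \<psi>)"
    using compose_dominant(1)[OF assms(1,2)] by (rule dominant_self_mapE)
  have "proj_eq (substitute \<phi> \<psi>) G"
    using proj_eq_sym[OF compose_dominant(2)[OF assms(1,2)]] assms(3) by (rule proj_eq_trans)
  from reduce_degree_minimal[OF nz this _ assms(4)] d show ?thesis
    using map_degree_eq[OF d dominant_self_map_nonzero[OF compose_dominant(1)[OF assms(1,2)]]]
    by (simp add: compose_def)
qed

lemma mutually_inverse_sym: "mutually_inverse \<phi> \<psi> \<Longrightarrow> mutually_inverse \<psi> \<phi>"
  by (auto simp: mutually_inverse_def)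

lemma mutually_inverse_substitute:
  assumes "mutually_inverse \<phi> \<psi>"
  shows "proj_eq (substitute \<phi> \<psi>) id_map"
proof -
  have eq: "proj_eq (compose \<phi> \<psi>) id_map" using assms by (simp add: mutually_inverse_def)
  have "substitute \<phi> \<psi> \<noteq> 0"
  proof
    assume "substitute \<phi> \<psi> = 0"
    then have "compose \<phi> \<psi> = 0" by (simp add: compose_def reduce_def vec_eq_iff)
    then show False using eq by (simp add: proj_eq_def)
  qed
  from proj_eq_reduce[OF this] eq show ?thesis
    unfolding compose_def by (rule proj_eq_trans)
qed

text \<open>
  If \<open>P\<close> vanishes on the image of \<open>\<phi>\<close>, then also after the further substitution of \<open>\<psi>\<close>, which gives
  back \<open>P\<close> up to a nonzero factor.
\<close>

lemma mutually_inverse_dominant: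
  assumes "mutually_inverse \<phi> \<psi>"
  shows "dominant_self_map \<phi>"
proof -
  obtain d e where d: "homogeneous_tuple d \<phi>" and e: "homogeneous_tuple e \<psi>"
    using assms by (auto simp: mutually_inverse_def rational_map_def homogeneous_tuple_def)
  have dom: "dominant_self_map (substitute \<phi> \<psi>)"
    using proj_eq_sym[OF mutually_inverse_substitute[OF assms]] dominant_self_map_id
      homogeneous_tuple_substitute[OF d e] by (rule dominant_self_map_proj_eq)
  have "P = 0" if P: "homogeneous n P" "eval3 const3 P \<phi> = 0" for n P
  proof -
    have "eval3 const3 P (substitute \<phi> \<psi>) = 0"
      unfolding eval3_substitute[symmetric] P(2)
      by (rule ring_homoD(1)[OF ring_homo_eval3[OF ring_homo_const3]])
    then show ?thesis using dom P(1) by (auto simp: dominant_self_map_def)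
  qed
  then show ?thesis using d by (auto simp: dominant_self_map_def)
qed

lemma cancel_inverse:
  assumes "dominant_self_map \<alpha>" "dominant_self_map \<beta>"
    and "mutually_inverse \<sigma> \<tau>"
  shows "proj_eq (substitute \<alpha> (substitute (substitute \<sigma> \<tau>) \<beta>)) (substitute \<alpha> \<beta>)"
proof -
  have \<sigma>\<tau>: "dominant_self_map (substitute \<sigma> \<tau>)"
    by (intro dominant_self_map_substitute mutually_inverse_dominant[OF assms(3)]
        mutually_inverse_dominant[OF mutually_inverse_sym[OF assms(3)]])
  have "proj_eq (substitute (substitute \<sigma> \<tau>) \<beta>) (substitute id_map \<beta>)"
    by (rule proj_eq_substitute[OF mutually_inverse_substitute[OF assms(3)] \<sigma>\<tau> dominant_self_map_id
          proj_eq_refl[OF dominant_self_map_nonzero[OF assms(2)]] assms(2)])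
  then have "proj_eq (substitute (substitute \<sigma> \<tau>) \<beta>) \<beta>" by (simp only: substitute_id_left)
  from proj_eq_substitute[OF proj_eq_refl[OF dominant_self_map_nonzero[OF assms(1)]] assms(1,1) this
      dominant_self_map_substitute[OF \<sigma>\<tau> assms(2)]]
  show ?thesis .
qed

lemma iterate_0: "iterate \<phi> 0 = id_map" and iterate_Suc: "iterate \<phi> (Suc n) = compose \<phi> (iterate \<phi> n)"
  by (simp_all add: iterate_def)

lemma iterate_dominant: "dominant_self_map \<phi> \<Longrightarrow> dominant_self_map (iterate \<phi> n)"
  by (induction n) (simp_all add: iterate_0 iterate_Suc dominant_self_map_id compose_dominant(1))

section \<open>Powers of matrices of polynomials\<close>

primrec matpow :: "'a::comm_ring_1^2^2 \<Rightarrow> nat \<Rightarrow> 'a^2^2"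
  where "matpow M 0 = mat 1" | "matpow M (Suc n) = M ** matpow M n"

lemma matrix_mult_2:
  fixes M N :: "'a::comm_ring_1^2^2"
  shows "(M ** N) $ i $ j = M$i$1 * N$1$j + M$i$2 * N$2$j"
  by (simp add: matrix_matrix_mult_def sum_2)

lemma trace_2: "trace (M :: 'a::comm_ring_1^2^2) = M$1$1 + M$2$2"
  by (simp add: trace_def sum_2)

lemma det_matpow: "det (matpow M n) = det M ^ n"
  by (induction n) (simp_all add: det_mul)

lemma trace_recursion:
  fixes M P :: "'a::comm_ring_1^2^2"
  shows "trace (M ** (M ** P)) = trace M * trace (M ** P) - det M * trace P"
  by (simp add: trace_2 matrix_mult_2 det_2 algebra_simps)

definition entries_le :: "nat \<Rightarrow> complex poly^2^2 \<Rightarrow> bool"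
  where "entries_le m M \<longleftrightarrow> (\<forall>i j. degree (M$i$j) \<le> m)"

lemma entries_le_mult:
  assumes "entries_le m M" "entries_le n N"
  shows "entries_le (m + n) (M ** N)"
  unfolding entries_le_def
proof (intro allI)
  fix i j
  have "degree (M$i$l * N$l$j) \<le> m + n" for l
    using assms degree_mult_le[of "M$i$l" "N$l$j"] by (fastforce simp: entries_le_def intro: order_trans add_mono)
  then show "degree ((M ** N)$i$j) \<le> m + n"
    unfolding matrix_mult_2 by (intro degree_add_le)
qed

lemma entries_le_matpow: "entries_le m M \<Longrightarrow> entries_le (n * m) (matpow M n)"
proof (induction n)
  case 0
  show ?case by (simp add: entries_le_def mat_def)
next
  case (Suc n)
  then show ?case using entries_le_mult[of m M "n * m" "matpow M n"] by simp
qed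

lemma ex_entries_le: "\<exists>m. entries_le m M"
proof -
  have "degree (M$i$j) \<le> (\<Sum>i\<in>UNIV. \<Sum>j\<in>UNIV. degree (M$i$j))" for i j
    by (rule order_trans[OF member_le_sum[of j UNIV] member_le_sum[of i UNIV]]) auto
  then show ?thesis by (auto simp: entries_le_def)
qed

text \<open>
  Equality in \<open>PGL\<^sub>2\<close> of the fraction field, with denominators cleared.
\<close>

definition proportional :: "'a::comm_ring_1^2^2 \<Rightarrow> 'a^2^2 \<Rightarrow> bool"
  where "proportional M N \<longleftrightarrow> (\<exists>h k. h \<noteq> 0 \<and> k \<noteq> 0 \<and> (\<forall>i j. h * M$i$j = k * N$i$j))"

lemma proportional_refl: "proportional M (M :: 'a::comm_ring_1^2^2)"
  unfolding proportional_def by (intro exI[of _ 1]) simp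

lemma proportional_sym: "proportional M N \<Longrightarrow> proportional N M"
  unfolding proportional_def by metis

lemma proportional_trace_det:
  fixes M N :: "'a::idom^2^2"
  assumes hk: "\<And>i j. h * M$i$j = k * N$i$j"
  shows "h * trace M = k * trace N" "h^2 * det M = k^2 * det N"
proof -
  show "h * trace M = k * trace N"
    unfolding trace_2 distrib_left hk ..
  have "h^2 * det M = (h * M$1$1) * (h * M$2$2) - (h * M$1$2) * (h * M$2$1)"
    by (simp add: det_2 power2_eq_square algebra_simps)
  also have "\<dots> = k^2 * det N"
    unfolding hk by (simp add: det_2 power2_eq_square algebra_simps)
  finally show "h^2 * det M = k^2 * det N" .
qed

lemma proportional_det:
  fixes M N :: "'a::idom^2^2"
  assumes "proportional M N"
  shows "det M = 0 \<longleftrightarrow> det N = 0"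
proof -
  obtain h k where hk: "h \<noteq> 0" "k \<noteq> 0" "\<And>i j. h * M$i$j = k * N$i$j"
    using assms unfolding proportional_def by blast
  show ?thesis using proportional_trace_det(2)[OF hk(3)] hk(1,2) by auto
qed

lemma proportional_index:
  fixes M N :: "'a::idom^2^2"
  assumes "proportional M N"
  shows "(trace M)^2 * det N = (trace N)^2 * det M"
proof -
  obtain h k where hk: "h \<noteq> 0" "k \<noteq> 0" "\<And>i j. h * M$i$j = k * N$i$j"
    using assms unfolding proportional_def by blast
  note td = proportional_trace_det[OF hk(3)]
  have tr: "h^2 * (trace M)^2 = k^2 * (trace N)^2"
    by (simp only: power_mult_distrib[symmetric] td(1))
  have "(h^2 * k^2) * ((trace M)^2 * det N) = (h^2 * (trace M)^2) * (k^2 * det N)"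
    by (simp only: mult_ac)
  also have "\<dots> = (k^2 * (trace N)^2) * (h^2 * det M)"
    by (simp only: tr td(2))
  also have "\<dots> = (h^2 * k^2) * ((trace N)^2 * det M)"
    by (simp only: mult_ac)
  finally show ?thesis using hk(1,2) by simp
qed

text \<open>
  The power sum \<open>u\<^sup>n + v\<^sup>n\<close> as a polynomial in \<open>s = u + v\<close> and \<open>q\<^sup>2 = u v\<close>.
\<close>

fun dickson :: "'a::comm_ring_1 \<Rightarrow> 'a \<Rightarrow> nat \<Rightarrow> 'a"
  where "dickson s q 0 = 2" | "dickson s q (Suc 0) = s"
  | "dickson s q (Suc (Suc n)) = s * dickson s q (Suc n) - q^2 * dickson s q n"

text \<open>
  For the eigenvalues \<open>\<lambda>\<close> and \<open>\<mu>\<close> of \<open>M\<close>, the left-hand side is the \<open>n\<close>-th power sum of \<open>\<lambda>\<^sup>2\<close> and \<open>\<mu>\<^sup>2\<close>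
  plus \<open>2 (\<lambda> \<mu>)\<^sup>n\<close>, and \<open>\<lambda>\<^sup>2 + \<mu>\<^sup>2 = tr\<^sup>2 - 2 det = k (p - 2 q)\<close>, \<open>\<lambda>\<^sup>2 \<mu>\<^sup>2 = (k q)\<^sup>2\<close>. Divided by
  \<open>(det M)\<^sup>n = k\<^sup>n q\<^sup>n\<close>, this is the index of \<open>M\<^sup>n\<close> with the common factor of \<open>tr\<^sup>2\<close> and \<open>det\<close> removed.
  The induction stays in the base ring.
\<close>

lemma trace_matpow_square:
  fixes M :: "'a::idom^2^2" and p q k :: 'a
  assumes tr: "(trace M)^2 = k * p" and det: "det M = k * q"
  shows "(trace (matpow M n))^2 = k ^ n * (dickson (p - 2 * q) q n + 2 * q ^ n)"
proof -
  define w where "w = dickson (p - 2 * q) q"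
  define T where "T n = trace (matpow M n)" for n
  have w: "w 0 = 2" "w (Suc 0) = p - 2 * q" "w (Suc (Suc n)) = (p - 2 * q) * w (Suc n) - q^2 * w n" for n
    by (simp_all add: w_def)
  have T: "T 0 = 2" "T (Suc 0) = trace M" "T (Suc (Suc n)) = trace M * T (Suc n) - k * q * T n" for n
    by (simp_all add: T_def trace_recursion det) (simp add: trace_2 mat_def)
  \<comment> \<open>Squaring the recursion for \<open>T\<close> produces the product of two neighbours, which becomes a
    polynomial in \<open>p\<close>, \<open>q\<close> and \<open>k\<close> after multiplication by the trace; it is carried along.\<close>
  have "(T n)^2 = k ^ n * (w n + 2 * q ^ n) \<and>
    (T (Suc n))^2 = k ^ Suc n * (w (Suc n) + 2 * q ^ Suc n) \<and>
    trace M * T n * T (Suc n) = k ^ Suc n * (w (Suc n) + q * w n + q ^ n * p)" for n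
  proof (induction n)
    case 0
    show ?case using tr by (simp add: T w algebra_simps power2_eq_square)
  next
    case (Suc n)
    then have 1: "(T n)^2 = k ^ n * (w n + 2 * q ^ n)"
      and 2: "(T (Suc n))^2 = k ^ Suc n * (w (Suc n) + 2 * q ^ Suc n)"
      and 3: "trace M * T n * T (Suc n) = k ^ Suc n * (w (Suc n) + q * w n + q ^ n * p)"
      by auto
    have "(T (Suc (Suc n)))^2 = (trace M)^2 * (T (Suc n))^2
        - 2 * (k * q) * (trace M * T n * T (Suc n)) + (k * q)^2 * (T n)^2"
      unfolding T by (simp add: power2_eq_square algebra_simps)
    also have "\<dots> = k ^ Suc (Suc n) * (w (Suc (Suc n)) + 2 * q ^ Suc (Suc n))"
      unfolding 1 2 3 tr w by (simp add: power2_eq_square algebra_simps)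
    finally have 4: "(T (Suc (Suc n)))^2 = k ^ Suc (Suc n) * (w (Suc (Suc n)) + 2 * q ^ Suc (Suc n))" .
    have "trace M * T (Suc n) * T (Suc (Suc n)) =
        (trace M)^2 * (T (Suc n))^2 - (k * q) * (trace M * T n * T (Suc n))"
      unfolding T by (simp add: power2_eq_square algebra_simps)
    also have "\<dots> = k ^ Suc (Suc n) * (w (Suc (Suc n)) + q * w (Suc n) + q ^ Suc n * p)"
      unfolding 2 3 tr w by (simp add: power2_eq_square algebra_simps)
    finally show ?case using 2 4 by simp
  qed
  then show ?thesis by (simp add: T_def w_def)
qed

text \<open>
  Hence the numerator of the index of \<open>M\<^sup>n\<close> is coprime to \<open>q\<close> whenever \<open>p\<close> is.
\<close>

lemma dickson_mod:
  fixes p q :: "'a::comm_ring_1"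
  shows "q dvd dickson (p - 2 * q) q (Suc n) - p ^ Suc n"
proof (induction n rule: less_induct)
  case (less n)
  show ?case
  proof (cases n)
    case 0
    then show ?thesis by simp
  next
    case (Suc l)
    have "dickson (p - 2 * q) q (Suc n) - p ^ Suc n =
      p * (dickson (p - 2 * q) q (Suc l) - p ^ Suc l) +
      q * (- 2 * dickson (p - 2 * q) q (Suc l) - q * dickson (p - 2 * q) q l)"
      by (simp add: Suc power2_eq_square algebra_simps)
    then show ?thesis using less.IH[of l] Suc by auto
  qed
qed

lemma degree_diff_eq_left: "degree q < degree p \<Longrightarrow> degree (p - q) = degree (p :: 'a::ab_group_add poly)"
  using degree_add_eq_left[of "- q" p] by simp

lemma degree_dickson:
  fixes s :: "complex poly"
  assumes s: "degree s > 0" and q: "degree q = 0"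
  shows "degree (dickson s q n) = n * degree s"
proof -
  have "degree (dickson s q n) = n * degree s \<and> degree (dickson s q (Suc n)) = Suc n * degree s"
  proof (induction n)
    case (Suc n)
    have 1: "degree (s * dickson s q (Suc n)) = Suc (Suc n) * degree s"
      using Suc s by (subst degree_mult_eq) auto
    have "degree (q^2 * dickson s q n) \<le> degree (q^2) + n * degree s"
      using Suc degree_mult_le[of "q^2" "dickson s q n"] by simp
    also have "degree (q^2) = 0" using q degree_power_le[of q 2] by simp
    also have "0 + n * degree s < Suc (Suc n) * degree s" using s by simp
    finally have "degree (q^2 * dickson s q n) < degree (s * dickson s q (Suc n))"
      unfolding 1 .
    then have "degree (dickson s q (Suc (Suc n))) = degree (s * dickson s q (Suc n))"
      by (simp add: degree_diff_eq_left del: mult_Suc)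
    then show ?case using Suc 1 by simp
  qed auto
  then show ?thesis ..
qed

lemma degree_trace_det:
  assumes "entries_le e N"
  shows "degree ((trace N)^2) \<le> 2 * e" "degree (det N) \<le> 2 * e"
proof -
  have d: "degree (N$i$j) \<le> e" for i j using assms by (auto simp: entries_le_def)
  have "degree (trace N) \<le> e" unfolding trace_2 by (intro degree_add_le d)
  then show "degree ((trace N)^2) \<le> 2 * e"
    using degree_power_le[of "trace N" 2] by simp
  have m: "degree (N$i$j * N$k$l) \<le> 2 * e" for i j k l
    using degree_mult_le[of "N$i$j" "N$k$l"] d[of i j] d[of k l] by linarith
  show "degree (det N) \<le> 2 * e" unfolding det_2 by (intro degree_diff_le m)
qed

text \<open>
  Write the index of \<open>M\<close> as a reduced fraction \<open>p / q\<close>. The index of \<open>M\<^sup>n\<close> is \<open>s / q\<^sup>n\<close> with \<open>s\<close> coprime to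
  \<open>q\<close>, and it equals \<open>(tr N)\<^sup>2 / det N\<close>. So \<open>q\<^sup>n\<close> divides \<open>det N\<close> and \<open>s\<close> divides \<open>(tr N)\<^sup>2\<close>, which bounds
  \<open>n deg q\<close> and \<open>deg s\<close> by \<open>2 * e\<close>. If \<open>q\<close> is constant, then \<open>p\<close> is not, and \<open>deg s = n deg p\<close>.
\<close>

lemma degree_ge_if_index_nonconstant:
  fixes M N :: "complex poly^2^2"
  assumes det: "det M \<noteq> 0" and nonconst: "\<nexists>c. (trace M)^2 = smult c (det M)"
    and pr: "proportional N (matpow M n)" and e: "entries_le e N"
  shows "n \<le> 2 * e"
proof (cases n)
  case 0
  then show ?thesis by simp
next
  case (Suc l)
  define k where "k = gcd ((trace M)^2) (det M)"
  have k: "k \<noteq> 0" using det by (simp add: k_def)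
  obtain p q where pq: "(trace M)^2 = k * p" "det M = k * q" "coprime p q"
    using gcd_coprime_exists[of "(trace M)^2" "det M"] k unfolding k_def by (auto simp: mult.commute)
  have q0: "q \<noteq> 0" using pq(2) det by auto
  define s where "s = dickson (p - 2 * q) q n + 2 * q ^ n"
  have "(k ^ n * q ^ n) * (trace N)^2 = k ^ n * s * det N"
    using proportional_index[OF pr] trace_matpow_square[OF pq(1,2), of n]
    by (simp add: s_def det_matpow pq(2) power_mult_distrib mult_ac)
  then have eq: "q ^ n * (trace N)^2 = s * det N" using k by simp
  have detN: "det N \<noteq> 0"
    using proportional_det[OF pr] det by (simp add: det_matpow)
  have "coprime s q"
  proof (rule coprimeI)
    fix c assume c: "c dvd s" "c dvd q"
    have "q dvd s - p ^ n"
    proof -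
      have "s - p ^ n = (dickson (p - 2 * q) q (Suc l) - p ^ Suc l) + q * (2 * q ^ l)"
        by (simp add: s_def Suc algebra_simps)
      then show ?thesis using dickson_mod[of q p l] by simp
    qed
    then have "c dvd s - p ^ n" using c(2) dvd_trans by blast
    then have "c dvd p ^ n" using c(1) by (metis dvd_diff_right_iff)
    moreover have "coprime (p ^ n) q" using pq(3) by simp
    ultimately show "is_unit c" using c(2) by (metis coprime_common_divisor)
  qed
  then have cop: "coprime s (q ^ n)" by simp
  show ?thesis
  proof (cases "degree q = 0")
    case False
    have "q ^ n dvd s * det N" using eq by (metis dvd_triv_left)
    then have "q ^ n dvd det N" using cop by (simp add: coprime_commute coprime_dvd_mult_right_iff)
    then have "n * degree q \<le> 2 * e"
      using dvd_imp_degree_le[of "q ^ n" "det N"] detN degree_trace_det(2)[OF e] q0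
      by (simp add: degree_power_eq)
    moreover have "n \<le> n * degree q" using False by simp
    ultimately show ?thesis by linarith
  next
    case True
    then obtain q' where q': "q = [:q':]" by (auto elim: degree_eq_zeroE)
    have "degree p \<noteq> 0"
    proof
      assume "degree p = 0"
      then obtain p' where p': "p = [:p':]" by (auto elim: degree_eq_zeroE)
      have "(trace M)^2 = smult (p' / q') (det M)"
        using q0 by (simp add: pq(1,2) p' q')
      then show False using nonconst by blast
    qed
    moreover have dp: "degree (p - 2 * q) = degree p"
      if "degree p > 0" using that by (intro degree_diff_eq_left) (simp add: q' numeral_poly)
    ultimately have dw: "degree (dickson (p - 2 * q) q n) = n * degree p" "n * degree p > 0"
      using degree_dickson[OF _ True, of "p - 2 * q" n] Suc by auto
    have "degree (2 * q ^ n) = 0"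
      using True degree_power_le[of q n] degree_mult_le[of 2 "q ^ n"] by (simp add: numeral_poly)
    then have ds: "degree s = n * degree p"
      using dw unfolding s_def by (subst degree_add_eq_left) auto
    then have s0: "s \<noteq> 0" using dw(2) by auto
    have "s dvd q ^ n * (trace N)^2" using eq by (metis dvd_triv_left)
    then have "s dvd (trace N)^2" using cop by (simp add: coprime_dvd_mult_right_iff)
    moreover have "(trace N)^2 \<noteq> 0" using eq s0 detN by auto
    ultimately have "n * degree p \<le> 2 * e"
      using dvd_imp_degree_le[of s "(trace N)^2"] degree_trace_det(1)[OF e] ds by simp
    moreover have "n \<le> n * degree p" using \<open>degree p \<noteq> 0\<close> by simp
    ultimately show ?thesis by linarith
  qed
qed

text \<open>
  If the trace vanishes, \<open>M\<^sup>2\<close> is scalar and the powers of \<open>M\<close> alternate between multiples of the identity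
  and of \<open>M\<close>. Otherwise put \<open>t = tr M\<close>: since \<open>det M\<close> is \<open>t\<^sup>2\<close> times a complex number, the matrix
  \<open>M / t\<close> satisfies a quadratic equation over \<open>\<complex>\<close>, so that its powers lie in the span over \<open>\<complex>\<close> of itself
  and the identity.
\<close>

lemma bounded_if_index_constant:
  fixes M :: "complex poly^2^2"
  assumes det: "det M \<noteq> 0" and const: "(trace M)^2 = smult c (det M)" and m: "entries_le m M"
  shows "\<exists>N. proportional N (matpow M n) \<and> entries_le m N"
proof (cases "trace M = 0")
  case True
  have sq: "(M ** (M ** P))$i$j = - det M * P$i$j" for P :: "complex poly^2^2" and i j
  proof -
    have a: "M$2$2 = - M$1$1" using True by (simp add: trace_2 eq_neg_iff_add_eq_0 add.commute)
    show ?thesis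
      using exhaust_2[of i] by (auto simp: matrix_mult_2 det_2 a algebra_simps)
  qed
  have "\<exists>k N. k \<noteq> 0 \<and> (N = M \<or> N = mat 1) \<and> (\<forall>i j. matpow M n$i$j = k * N$i$j)"
  proof (induction n)
    case 0
    show ?case by (rule exI[of _ 1], rule exI[of _ "mat 1"]) simp
  next
    case (Suc n)
    then obtain k N where kN: "k \<noteq> 0" "N = M \<or> N = mat 1" "\<And>i j. matpow M n$i$j = k * N$i$j"
      by blast
    have step: "matpow M (Suc n)$i$j = k * (M ** N)$i$j" for i j
      by (simp add: matrix_mult_2 kN(3) algebra_simps)
    show ?case
    proof (cases "N = M")
      case True
      have "(M ** M)$i$j = - det M * (mat 1 :: complex poly^2^2)$i$j" for i j
        using sq[of "mat 1" i j] by simp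
      then have "matpow M (Suc n)$i$j = (k * - det M) * (mat 1 :: complex poly^2^2)$i$j" for i j
        unfolding step True by (simp only: mult.assoc)
      moreover have "k * - det M \<noteq> 0" using kN(1) det by simp
      ultimately show ?thesis by (intro exI[of _ "k * - det M"] exI[of _ "mat 1"]) blast
    next
      case False
      then have "M ** N = M" using kN(2) by simp
      then have "\<forall>i j. matpow M (Suc n)$i$j = k * M$i$j" using step by simp
      then show ?thesis using kN(1) by blast
    qed
  qed
  then obtain k N where N: "k \<noteq> 0" "N = M \<or> N = mat 1" "\<forall>i j. matpow M n$i$j = k * N$i$j"
    by blast
  have "entries_le m (mat 1)" by (simp add: entries_le_def mat_def)
  with N(2) m have "entries_le m N" by auto
  moreover have "proportional N (matpow M n)"
    unfolding proportional_def using N(1,3) by (intro exI[of _ k] exI[of _ 1]) (simp add: one_neq_zero)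
  ultimately show ?thesis by blast
next
  case False
  define t where "t = trace M"
  have c: "c \<noteq> 0" using False const by auto
  then have detc: "det M = smult (1 / c) (t^2)" using const by (simp add: t_def)
  have "\<exists>a b. \<forall>i j. t * matpow M n$i$j = t ^ n * (smult a (M$i$j) + smult b (t * mat 1$i$j))"
  proof (induction n)
    case 0
    show ?case by (rule exI[of _ 0], rule exI[of _ 1]) simp
  next
    case (Suc n)
    then obtain a b where ab: "\<And>i j. t * matpow M n$i$j =
        t ^ n * (smult a (M$i$j) + smult b (t * mat 1$i$j))"
      by blast
    have CH: "M$i$1 * M$1$j + M$i$2 * M$2$j = t * M$i$j - det M * mat 1$i$j" for i j
      using exhaust_2[of i] exhaust_2[of j]
      by (auto simp: t_def trace_2 det_2 mat_def algebra_simps)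
    have id: "M$i$1 * mat 1$1$j + M$i$2 * mat 1$2$j = M$i$j" for i j
      using exhaust_2[of j] by (auto simp: mat_def)
    have "t * matpow M (Suc n)$i$j =
        t ^ Suc n * (smult (a + b) (M$i$j) + smult (- a / c) (t * mat 1$i$j))" for i j
    proof -
      have "t * matpow M (Suc n)$i$j = M$i$1 * (t * matpow M n$1$j) + M$i$2 * (t * matpow M n$2$j)"
        by (simp only: matpow.simps matrix_mult_2 distrib_left mult.left_commute)
      also have "\<dots> = t ^ n * (smult a (M$i$1 * M$1$j + M$i$2 * M$2$j)
          + smult b (t * (M$i$1 * mat 1$1$j + M$i$2 * mat 1$2$j)))"
        unfolding ab by (simp add: algebra_simps smult_add_right)
      also have "\<dots> = t ^ Suc n * (smult (a + b) (M$i$j) + smult (- a / c) (t * mat 1$i$j))"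
        unfolding CH id detc
        by (simp add: algebra_simps smult_add_right smult_add_left smult_diff_right power2_eq_square)
      finally show ?thesis .
    qed
    then show ?case by blast
  qed
  then obtain a b where ab: "\<And>i j. t * matpow M n$i$j =
      t ^ n * (smult a (M$i$j) + smult b (t * mat 1$i$j))"
    by blast
  define N :: "complex poly^2^2" where "N = (\<chi> i j. smult a (M$i$j) + smult b (t * mat 1$i$j))"
  have "t ^ n * N$i$j = t * matpow M n$i$j" for i j by (simp add: N_def ab)
  moreover have "t \<noteq> 0" "t ^ n \<noteq> 0" using False by (auto simp: t_def)
  ultimately have "proportional N (matpow M n)"
    unfolding proportional_def by (intro exI[of _ "t ^ n"] exI[of _ t]) simp
  moreover have "entries_le m N"
    unfolding entries_le_def
  proof (intro allI)
    fix i j :: 2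
    have d: "degree (M$i$j) \<le> m" for i j using m by (auto simp: entries_le_def)
    have "degree t \<le> m" unfolding t_def trace_2 by (intro degree_add_le d)
    then have "degree (t * mat 1$i$j) \<le> m" by (simp add: mat_def)
    then show "degree (N$i$j) \<le> m" unfolding N_def vec_lambda_beta
      by (intro degree_add_le order_trans[OF degree_smult_le] d)
  qed
  ultimately show ?thesis by blast
qed

section \<open>Jonquieres maps and their matrices\<close>

text \<open>
  This is \<open>z\<^sup>m a(y / z)\<close>, provided that \<open>m\<close> is at least the degree of \<open>a\<close>.
\<close>

definition homogenise :: "nat \<Rightarrow> complex poly \<Rightarrow> poly3"
  where "homogenise m a = (\<Sum>j\<le>m. const3 (coeff a j) * (Y ^ j * Z ^ (m - j)))"

lemma homogeneous_homogenise: "homogeneous m (homogenise m a)"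
  unfolding homogenise_def
proof (rule homogeneous_sum)
  fix j assume "j \<in> {..m}"
  then show "homogeneous m (const3 (coeff a j) * (Y ^ j * Z ^ (m - j)))"
    using homogeneous_monomial[of 0 j "m - j"] by simp
qed

lemma poly_homogenise:
  assumes "degree a \<le> m"
  shows "poly (homogenise m a) 1 = [:a:]"
proof -
  have c: "[:[:c:]:] * [:[:0, 1:]:] ^ j = [:monom c j:]" for c :: complex and j
    by (simp add: monom_altdef ring_homo_power[OF ring_homo_const_poly, symmetric])
  have "poly (homogenise m a) 1 = (\<Sum>j\<le>m. [:monom (coeff a j) j:])"
    by (simp only: homogenise_def poly_sum poly_mult poly_power c[symmetric])
      (simp add: const3_def Y_def Z_def)
  also have "\<dots> = [:\<Sum>j\<le>m. monom (coeff a j) j:]"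
    by (rule ring_homo_sum[OF ring_homo_const_poly, symmetric])
  finally show ?thesis by (simp add: poly_as_sum_of_monoms'[OF assms])
qed

lemma eval3_homogenise:
  fixes \<phi> :: "poly3^3"
  assumes "\<phi>$2 = q * Y" "\<phi>$3 = q * Z"
  shows "eval3 const3 (homogenise m a) \<phi> = q ^ m * homogenise m a"
proof -
  note h = ring_homo_eval3[OF ring_homo_const3, of \<phi>]
  have "eval3 const3 (const3 c * (Y ^ j * Z ^ (m - j))) \<phi> =
      q ^ m * (const3 c * (Y ^ j * Z ^ (m - j)))" if "j \<le> m" for c j
  proof -
    have "eval3 const3 (const3 c * (Y ^ j * Z ^ (m - j))) \<phi> =
        const3 c * ((q * Y) ^ j * (q * Z) ^ (m - j))"
      by (simp only: ring_homoD(4)[OF h] ring_homo_power[OF h]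
          eval3_generators[OF ring_homo_const3] assms)
    also have "\<dots> = q ^ (j + (m - j)) * (const3 c * (Y ^ j * Z ^ (m - j)))"
      by (simp only: power_mult_distrib power_add mult_ac)
    finally show ?thesis using that by simp
  qed
  then show ?thesis
    unfolding homogenise_def ring_homo_sum[OF h] sum_distrib_left by (intro sum.cong) auto
qed

definition linear_form :: "nat \<Rightarrow> complex poly \<Rightarrow> complex poly \<Rightarrow> poly3"
  where "linear_form m a b = homogenise m a * X + homogenise m b * Z"

lemma homogeneous_linear_form: "homogeneous (Suc m) (linear_form m a b)"
  unfolding linear_form_def
  using homogeneous_add homogeneous_mult[OF homogeneous_homogenise homogeneous_generators(1)]
    homogeneous_mult[OF homogeneous_homogenise homogeneous_generators(3)] by simp

lemma poly_linear_form:
  "degree a \<le> m \<Longrightarrow> degree b \<le> m \<Longrightarrow> poly (linear_form m a b) 1 = [:b, a:]"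
  by (simp add: linear_form_def poly_homogenise X_def Z_def)

lemma poly_generators: "poly X 1 = [:0, 1:]" "poly Y 1 = [:[:0, 1:]:]" "poly Z 1 = 1"
  by (simp_all add: X_def Y_def Z_def)

lemma generators_nonzero: "X \<noteq> 0" "Y \<noteq> 0" "Z \<noteq> 0"
  by (simp_all add: X_def Y_def Z_def)

text \<open>
  The map \<open>((A x + B) / (C x + D), y)\<close> in homogeneous coordinates. All entries of \<open>M\<close> are homogenised in
  the same degree \<open>m\<close>; common factors are tolerated, so that \<open>m\<close> may be any bound for the degrees.
\<close>

definition jonquieres_tuple :: "nat \<Rightarrow> complex poly^2^2 \<Rightarrow> poly3^3"
  where "jonquieres_tuple m M = vector
    [Z * linear_form m (M$1$1) (M$1$2), linear_form m (M$2$1) (M$2$2) * Y,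
     linear_form m (M$2$1) (M$2$2) * Z]"

lemma jonquieres_tuple_simps:
  "jonquieres_tuple m M $ 1 = Z * linear_form m (M$1$1) (M$1$2)"
  "jonquieres_tuple m M $ 2 = linear_form m (M$2$1) (M$2$2) * Y"
  "jonquieres_tuple m M $ 3 = linear_form m (M$2$1) (M$2$2) * Z"
  by (simp_all add: jonquieres_tuple_def vector_3)

lemma homogeneous_jonquieres_tuple: "homogeneous_tuple (m + 2) (jonquieres_tuple m M)"
  using homogeneous_mult[OF homogeneous_generators(3) homogeneous_linear_form]
    homogeneous_mult[OF homogeneous_linear_form homogeneous_generators(2)]
    homogeneous_mult[OF homogeneous_linear_form homogeneous_generators(3)]
  by (simp add: homogeneous_tuple_def forall_3 jonquieres_tuple_simps)

lemma linear_form_nonzero: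
  assumes "det M \<noteq> 0" "entries_le m M"
  shows "linear_form m (M$2$1) (M$2$2) \<noteq> 0"
proof
  assume "linear_form m (M$2$1) (M$2$2) = 0"
  moreover have "poly (linear_form m (M$2$1) (M$2$2)) 1 = [:M$2$2, M$2$1:]"
    using assms(2) by (intro poly_linear_form) (auto simp: entries_le_def)
  ultimately have "M$2$1 = 0" "M$2$2 = 0" by auto
  then show False using assms(1) by (simp add: det_2)
qed

text \<open>
  Together with the next lemma this translates between the affine description and homogeneous
  triples.
\<close>

lemma proj_eq_jonquieres_tuple:
  assumes F: "homogeneous_tuple e F" "F \<noteq> 0" and J: "jonquieres F M" and m: "entries_le m M"
  shows "proj_eq F (jonquieres_tuple m M)"
proof -
  define r s where "r = linear_form m (M$1$1) (M$1$2)" and "s = linear_form m (M$2$1) (M$2$2)"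
  have d: "degree (M$i$j) \<le> m" for i j using m by (auto simp: entries_le_def)
  have Fh: "homogeneous e (F$i)" for i using F(1) by (auto simp: homogeneous_tuple_def)
  have rs: "poly r 1 = [:M$1$2, M$1$1:]" "poly s 1 = [:M$2$2, M$2$1:]"
    unfolding r_def s_def by (intro poly_linear_form d)+
  have h: "homogeneous (Suc m) r" "homogeneous (Suc m) s"
    unfolding r_def s_def by (rule homogeneous_linear_form)+
  have 1: "F$1 * s = F$3 * r"
    by (rule homogeneous_dehomogenise_inj[OF homogeneous_mult[OF Fh h(2)] homogeneous_mult[OF Fh h(1)]])
      (use J rs in \<open>simp only: poly_mult jonquieres_def\<close>)
  have 2: "F$2 * Z = F$3 * Y"
    by (rule homogeneous_dehomogenise_inj[OF homogeneous_mult[OF Fh homogeneous_generators(3)]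
          homogeneous_mult[OF Fh homogeneous_generators(2)]])
      (use J in \<open>simp add: poly_generators jonquieres_def\<close>)
  have s: "s \<noteq> 0"
    unfolding s_def using J m by (intro linear_form_nonzero) (auto simp: jonquieres_def)
  have F3: "F$3 \<noteq> 0"
  proof
    assume "F$3 = 0"
    then have "\<forall>i. F$i = 0" using 1 2 s generators_nonzero by (auto simp: forall_3)
    then show False using F(2) by (simp add: vec_eq_iff)
  qed
  show ?thesis
  proof (rule proj_eqI[OF F(2), of "s * Z" "F$3"])
    show "s * Z \<noteq> 0" using s generators_nonzero by simp
    fix i
    have "s * Z * F$1 = F$3 * (Z * r)"
    proof -
      have "s * Z * F$1 = Z * (F$1 * s)" by (simp only: mult_ac)
      then show ?thesis unfolding 1 by (simp only: mult_ac)
    qed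
    moreover have "s * Z * F$2 = F$3 * (s * Y)"
    proof -
      have "s * Z * F$2 = s * (F$2 * Z)" by (simp only: mult_ac)
      then show ?thesis unfolding 2 by (simp only: mult_ac)
    qed
    moreover have "s * Z * F$3 = F$3 * (s * Z)" by (simp only: mult_ac)
    ultimately show "s * Z * F$i = F$3 * jonquieres_tuple m M$i"
      using exhaust_3[of i] by (auto simp only: jonquieres_tuple_simps r_def[symmetric] s_def[symmetric])
  qed (rule F3)
qed

lemma jonquieres_if_proj_eq:
  assumes eq: "proj_eq F (jonquieres_tuple m M)" and det: "det M \<noteq> 0" and m: "entries_le m M"
  shows "jonquieres F M"
proof -
  define r s where "r = linear_form m (M$1$1) (M$1$2)" and "s = linear_form m (M$2$1) (M$2$2)"
  have d: "degree (M$i$j) \<le> m" for i j using m by (auto simp: entries_le_def)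
  have rs: "poly r 1 = [:M$1$2, M$1$1:]" "poly s 1 = [:M$2$2, M$2$1:]"
    unfolding r_def s_def by (intro poly_linear_form d)+
  have s: "s \<noteq> 0" unfolding s_def by (rule linear_form_nonzero[OF det m])
  have "F$1 * jonquieres_tuple m M$3 = F$3 * jonquieres_tuple m M$1"
    "F$2 * jonquieres_tuple m M$3 = F$3 * jonquieres_tuple m M$2"
    using eq by (simp_all only: proj_eq_def)
  then have "Z * (F$1 * s) = Z * (F$3 * r)" "s * (F$2 * Z) = s * (Y * F$3)"
    by (simp_all only: jonquieres_tuple_simps r_def[symmetric] s_def[symmetric] mult_ac)
  then have "F$1 * s = F$3 * r" "F$2 * Z = Y * F$3" using s generators_nonzero by simp_all
  then have "poly (F$1 * s) 1 = poly (F$3 * r) 1" "poly (F$2 * Z) 1 = poly (Y * F$3) 1" by simp_all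
  then show ?thesis using det by (simp only: jonquieres_def poly_mult rs poly_generators mult_1_right) simp
qed

lemma jonquieres_proportional:
  assumes "jonquieres F N" "proportional N M" "det M \<noteq> 0"
  shows "jonquieres F M"
proof -
  obtain h k where hk: "h \<noteq> 0" "k \<noteq> 0" "\<And>i j. h * N$i$j = k * M$i$j"
    using assms(2) unfolding proportional_def by blast
  define f g where "f = poly (F$1) 1" and "g = poly (F$3) 1"
  have "f * [:N$2$2, N$2$1:] = g * [:N$1$2, N$1$1:]"
    using assms(1) by (simp add: jonquieres_def f_def g_def)
  then have "smult h (f * [:N$2$2, N$2$1:]) = smult h (g * [:N$1$2, N$1$1:])" by simp
  then have "f * smult h [:N$2$2, N$2$1:] = g * smult h [:N$1$2, N$1$1:]"
    by (simp only: mult_smult_right)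
  then have "f * [:k * M$2$2, k * M$2$1:] = g * [:k * M$1$2, k * M$1$1:]"
    by (simp only: smult_pCons hk(3) smult_0_right)
  moreover have "[:k * M$i$j, k * M$i$l:] = smult k [:M$i$j, M$i$l:]" for i j l by simp
  ultimately have "smult k (f * [:M$2$2, M$2$1:]) = smult k (g * [:M$1$2, M$1$1:])"
    by (simp only: mult_smult_right)
  then have "f * [:M$2$2, M$2$1:] = g * [:M$1$2, M$1$1:]" by (rule smult_cancel[OF hk(2)])
  then show ?thesis using assms(1,3) by (simp add: jonquieres_def f_def g_def)
qed

text \<open>
  If \<open>s\<close> is the homogenised second row of \<open>N\<close>, the last two coordinates of the inner map are \<open>s y\<close> and
  \<open>s z\<close>. Substituting them into a form of degree \<open>m\<close> in \<open>y\<close> and \<open>z\<close> just multiplies it by \<open>s\<^sup>m\<close>, so the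
  composition is the triple of \<open>M N\<close> multiplied by \<open>s\<^sup>m z s\<close>.
\<close>

lemma substitute_jonquieres_tuple:
  assumes M: "entries_le m M" and N: "entries_le n N"
    and nz: "det M \<noteq> 0" "det N \<noteq> 0"
  shows "proj_eq (substitute (jonquieres_tuple m M) (jonquieres_tuple n N))
    (jonquieres_tuple (m + n) (M ** N))"
proof -
  define r s where "r = linear_form n (N$1$1) (N$1$2)" and "s = linear_form n (N$2$1) (N$2$2)"
  define \<phi> where "\<phi> = jonquieres_tuple n N"
  note h = ring_homo_eval3[OF ring_homo_const3, of \<phi>]
  have \<phi>: "\<phi>$1 = Z * r" "\<phi>$2 = s * Y" "\<phi>$3 = s * Z"
    by (simp_all only: \<phi>_def jonquieres_tuple_simps r_def s_def)
  have dN: "degree (N$i$j) \<le> n" and dM: "degree (M$i$j) \<le> m" for i j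
    using M N by (auto simp: entries_le_def)
  have dMN: "degree ((M ** N)$i$j) \<le> m + n" for i j
    using entries_le_mult[OF M N] by (auto simp: entries_le_def)
  have rs: "poly r 1 = [:N$1$2, N$1$1:]" "poly s 1 = [:N$2$2, N$2$1:]"
    unfolding r_def s_def by (intro poly_linear_form dN)+
  have hrs: "homogeneous (Suc n) r" "homogeneous (Suc n) s"
    unfolding r_def s_def by (rule homogeneous_linear_form)+
  have row: "eval3 const3 (linear_form m (M$i$1) (M$i$2)) \<phi> =
      s ^ m * Z * linear_form (m + n) ((M ** N)$i$1) ((M ** N)$i$2)" for i
  proof -
    have "homogenise m (M$i$1) * r + homogenise m (M$i$2) * s =
        linear_form (m + n) ((M ** N)$i$1) ((M ** N)$i$2)"
    proof (rule homogeneous_dehomogenise_inj)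
      show "homogeneous (Suc (m + n)) (homogenise m (M$i$1) * r + homogenise m (M$i$2) * s)"
        using homogeneous_add[OF homogeneous_mult[OF homogeneous_homogenise hrs(1)]
            homogeneous_mult[OF homogeneous_homogenise hrs(2)]] by simp
      show "homogeneous (Suc (m + n)) (linear_form (m + n) ((M ** N)$i$1) ((M ** N)$i$2))"
        by (rule homogeneous_linear_form)
      have "poly (homogenise m (M$i$1) * r + homogenise m (M$i$2) * s) 1 =
          [:M$i$1:] * [:N$1$2, N$1$1:] + [:M$i$2:] * [:N$2$2, N$2$1:]"
        by (simp only: poly_add poly_mult rs poly_homogenise[OF dM])
      also have "\<dots> = [:(M ** N)$i$2, (M ** N)$i$1:]" by (simp add: matrix_mult_2)
      also have "\<dots> = poly (linear_form (m + n) ((M ** N)$i$1) ((M ** N)$i$2)) 1"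
        by (rule poly_linear_form[OF dMN dMN, symmetric])
      finally show "poly (homogenise m (M$i$1) * r + homogenise m (M$i$2) * s) 1 =
          poly (linear_form (m + n) ((M ** N)$i$1) ((M ** N)$i$2)) 1" .
    qed
    moreover have "eval3 const3 (linear_form m (M$i$1) (M$i$2)) \<phi> =
        s ^ m * homogenise m (M$i$1) * (Z * r) + s ^ m * homogenise m (M$i$2) * (s * Z)"
      by (simp only: linear_form_def ring_homoD[OF h] eval3_homogenise[OF \<phi>(2,3)]
          eval3_generators[OF ring_homo_const3] \<phi>)
    then have "eval3 const3 (linear_form m (M$i$1) (M$i$2)) \<phi> =
        s ^ m * Z * (homogenise m (M$i$1) * r + homogenise m (M$i$2) * s)"
      by (simp only: distrib_left mult_ac)
    ultimately show ?thesis by simp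
  qed
  have s: "s \<noteq> 0" unfolding s_def by (rule linear_form_nonzero[OF nz(2) N])
  have detMN: "det (M ** N) \<noteq> 0" using nz by (simp add: det_mul)
  have "jonquieres_tuple (m + n) (M ** N) $ 3 \<noteq> 0"
    using linear_form_nonzero[OF detMN entries_le_mult[OF M N]] generators_nonzero
    by (simp add: jonquieres_tuple_simps)
  then have J: "jonquieres_tuple (m + n) (M ** N) \<noteq> 0" by auto
  have "proj_eq (jonquieres_tuple (m + n) (M ** N)) (substitute (jonquieres_tuple m M) \<phi>)"
  proof (rule proj_eqI[OF J, of "s ^ m * Z * s" 1])
    show "s ^ m * Z * s \<noteq> 0" using s generators_nonzero by simp
    fix i :: 3
    show "s ^ m * Z * s * jonquieres_tuple (m + n) (M ** N)$i =
        1 * substitute (jonquieres_tuple m M) \<phi>$i"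
      using exhaust_3[of i]
      by (auto simp only: substitute_def vec_lambda_beta jonquieres_tuple_simps ring_homoD[OF h] row
          eval3_generators[OF ring_homo_const3] \<phi> mult_1 mult_ac)
  qed simp
  then show ?thesis unfolding \<phi>_def by (rule proj_eq_sym)
qed

text \<open>
  Here \<open>y\<close> is the variable of the coefficients. When \<open>x\<close> is specialised to a complex number \<open>c\<close> that is
  not a root of \<open>k\<close>, the degree in \<open>y\<close> becomes additive, which bounds the degree of \<open>b + c a\<close>. Two such
  values of \<open>c\<close> determine \<open>a\<close> and \<open>b\<close>.
\<close>

lemma degree_linear_factor:
  fixes k :: "complex poly poly"
  assumes k: "k \<noteq> 0" and e: "\<And>i. degree (coeff (k * [:b, a:]) i) \<le> e"
  shows "degree a \<le> e" "degree b \<le> e"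
proof -
  have eval: "degree (poly p [:c:]) \<le> e" if "\<forall>i. degree (coeff p i) \<le> e"
    for p :: "complex poly poly" and c
    using that
  proof (induction p)
    case (pCons d p)
    have "\<forall>i. degree (coeff p i) \<le> e" using pCons.prems by (metis coeff_pCons_Suc)
    then have "degree ([:c:] * poly p [:c:]) \<le> e" using pCons.IH by (auto intro: order_trans[OF degree_smult_le])
    moreover have "degree d \<le> e" using pCons.prems by (metis coeff_pCons_0)
    ultimately show ?case by (simp add: degree_add_le)
  qed simp
  have "finite {c. poly k [:c:] = 0}"
  proof -
    have "finite ((\<lambda>c. [:c:]) -` {x. poly k x = 0})"
      by (rule finite_vimageI[OF poly_roots_finite[OF k]]) (auto simp: inj_on_def)
    then show ?thesis by (simp add: vimage_def)
  qed
  then have inf: "infinite (UNIV - {c. poly k [:c:] = 0})"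
    by (rule Diff_infinite_finite) (rule infinite_UNIV_char_0)
  have lin: "degree (b + smult c a) \<le> e" if "poly k [:c:] \<noteq> 0" for c
  proof (cases "b + smult c a = 0")
    case False
    have "poly (k * [:b, a:]) [:c:] = poly k [:c:] * (b + smult c a)"
      by (simp only: poly_mult) simp
    then have "degree (poly k [:c:] * (b + smult c a)) \<le> e"
      using eval[of "k * [:b, a:]" c, OF allI, OF e] by (simp only:)
    then show ?thesis using False that by (simp add: degree_mult_eq)
  qed simp
  obtain c1 where c1: "poly k [:c1:] \<noteq> 0" using infinite_imp_nonempty[OF inf] by auto
  have "infinite (UNIV - {c. poly k [:c:] = 0} - {c1})" by (rule Diff_infinite_finite[OF _ inf]) simp
  then obtain c2 where c2: "poly k [:c2:] \<noteq> 0" "c2 \<noteq> c1" using infinite_imp_nonempty by blast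
  have "degree ((b + smult c1 a) - (b + smult c2 a)) \<le> e"
    by (intro degree_diff_le lin c1 c2)
  moreover have "(b + smult c1 a) - (b + smult c2 a) = smult (c1 - c2) a"
    by (simp add: smult_diff_left)
  ultimately show a: "degree a \<le> e" using c2 by simp
  have "degree ((b + smult c1 a) - smult c1 a) \<le> e"
    using a by (intro degree_diff_le lin c1) simp
  then show "degree b \<le> e" by simp
qed

lemma degree_coeff_dehomogenise:
  assumes "homogeneous e P"
  shows "degree (coeff (poly P 1) i) \<le> e"
proof (rule degree_le, intro allI impI)
  fix j assume "e < j"
  then have "coeff3 P i j k = 0" for k using assms unfolding homogeneous_def by fastforce
  then show "coeff (coeff (poly P 1) i) j = 0" by (simp add: poly_altdef coeff_sum)
qed

text \<open>
  Let \<open>P = A x + B\<close> and \<open>Q = C x + D\<close>. A common divisor of \<open>P\<close> and \<open>Q\<close> divides \<open>A Q - C P = det M\<close>, so it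
  does not involve \<open>x\<close>, and \<open>N\<close> is obtained from \<open>M\<close> by dividing by it. As the rows of \<open>N\<close> are coprime,
  the first and the third coordinate of \<open>F\<close> are the same multiple of them, and the degrees of the
  entries are bounded by those of \<open>F\<close>.
\<close>

lemma jonquieres_reduced_matrix:
  assumes F: "homogeneous_tuple e F" "F \<noteq> 0" and J: "jonquieres F M"
  shows "\<exists>N. proportional N M \<and> entries_le e N"
proof -
  define P Q where "P = [:M$1$2, M$1$1:]" and "Q = [:M$2$2, M$2$1:]"
  define f g where "f = poly (F$1) 1" and "g = poly (F$3) 1"
  have det: "det M \<noteq> 0" and fg: "f * Q = g * P" and F2: "poly (F$2) 1 = [:[:0, 1:]:] * g"
    using J by (auto simp: jonquieres_def f_def g_def P_def Q_def)
  have Fh: "homogeneous e (F$i)" for i using F(1) by (auto simp: homogeneous_tuple_def)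
  define D where "D = gcd P Q"
  have Q0: "Q \<noteq> 0" using det by (auto simp: Q_def det_2)
  then have D0: "D \<noteq> 0" by (simp add: D_def)
  then obtain P' Q' where PQ: "P = P' * D" "Q = Q' * D" "coprime P' Q'"
    using gcd_coprime_exists[of P Q] unfolding D_def by auto
  have "[:det M:] = [:M$1$1:] * Q - [:M$2$1:] * P"
    by (simp add: P_def Q_def det_2 mult.commute)
  moreover have "D dvd [:M$1$1:] * Q - [:M$2$1:] * P"
    unfolding D_def by (intro dvd_diff dvd_mult gcd_dvd1 gcd_dvd2)
  ultimately have "D dvd [:det M:]" by (simp only:)
  then have "degree D = 0" using dvd_imp_degree_le[of D "[:det M:]"] det by simp
  then obtain h where h: "D = [:h:]" by (auto elim: degree_eq_zeroE)
  then have h0: "h \<noteq> 0" using D0 by simp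
  have P': "P = smult h P'" and Q': "Q = smult h Q'" using PQ(1,2) h by (simp_all add: mult.commute)
  define N :: "complex poly^2^2" where
    "N = (\<chi> i j. coeff (if i = 1 then P' else Q') (if j = 1 then 1 else 0))"
  have N: "h * N$i$j = 1 * M$i$j" for i j
  proof -
    have "h * coeff P' l = coeff P l" "h * coeff Q' l = coeff Q l" for l
      by (simp_all add: P' Q')
    then show ?thesis
      using exhaust_2[of i] exhaust_2[of j] by (auto simp: N_def P_def Q_def)
  qed
  have prop_N: "proportional N M"
    unfolding proportional_def using h0 N by (intro exI[of _ h] exI[of _ 1]) simp
  have lin: "p = [:coeff p 0, coeff p 1:]" if "degree p \<le> 1" for p :: "complex poly poly"
  proof -
    have "p = (\<Sum>i\<le>1. monom (coeff p i) i)" using poly_as_sum_of_monoms'[OF that] by simp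
    then show ?thesis by (simp add: monom_altdef)
  qed
  have "degree P \<le> 1" "degree Q \<le> 1" by (simp_all add: P_def Q_def)
  then have "degree P' \<le> 1" "degree Q' \<le> 1" using h0 by (simp_all add: P' Q')
  then have N': "P' = [:N$1$2, N$1$1:]" "Q' = [:N$2$2, N$2$1:]"
    using lin by (auto simp: N_def)
  have "D * (f * Q') = D * (g * P')"
    using fg unfolding PQ(1,2) by (simp only: mult_ac)
  then have fg': "f * Q' = g * P'" using D0 by simp
  then have "Q' dvd g * P'" by (metis dvd_triv_right)
  then have "Q' dvd g" using PQ(3) by (simp add: coprime_commute coprime_dvd_mult_left_iff)
  then obtain k where g: "g = k * Q'" by (metis dvd_def mult.commute)
  have "Q' \<noteq> 0" using Q0 Q' by auto
  moreover have "Q' * f = Q' * (k * P')" using fg' unfolding g by (simp only: mult_ac)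
  ultimately have f: "f = k * P'" by simp
  have k: "k \<noteq> 0"
  proof
    assume "k = 0"
    then have "\<forall>i. poly (F$i) 1 = 0" using f g F2 by (simp add: forall_3 f_def g_def)
    then have "F$i = 0" for i
      by (intro homogeneous_dehomogenise_inj[OF Fh]) (auto simp: homogeneous_def)
    then show False using F(2) by (simp add: vec_eq_iff)
  qed
  have deg: "degree (coeff (k * [:N$1$2, N$1$1:]) i) \<le> e" "degree (coeff (k * [:N$2$2, N$2$1:]) i) \<le> e" for i
    unfolding N'[symmetric] f[symmetric] g[symmetric] f_def g_def
    by (intro degree_coeff_dehomogenise Fh)+
  have "degree (N$1$1) \<le> e" "degree (N$1$2) \<le> e" "degree (N$2$1) \<le> e" "degree (N$2$2) \<le> e"
    by (rule degree_linear_factor[OF k deg(1)] degree_linear_factor[OF k deg(2)])+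
  then have "entries_le e N" by (simp add: entries_le_def forall_2)
  with prop_N show ?thesis by blast
qed

section \<open>Growth of the degrees\<close>

lemma linear_growth_if_bounds:
  fixes d :: "nat \<Rightarrow> nat"
  assumes lower: "\<And>n. n \<le> A * d n" and upper: "\<And>n. 0 < n \<Longrightarrow> d n \<le> B * n"
  shows "\<exists>c C :: real. 0 < c \<and> c \<le> C \<and>
    (\<forall>\<^sub>F n in sequentially. c * real n \<le> real (d n) \<and> real (d n) \<le> C * real n)"
proof -
  \<comment> \<open>The summand \<open>1\<close> covers \<open>A = 0\<close>.\<close>
  define c :: real where "c = 1 / (real A + 1)"
  define C where "C = max c (real B)"
  have lo: "c * real n \<le> real (d n)" for n
  proof -
    have "real n \<le> real A * real (d n)" using lower[of n] by (metis of_nat_le_iff of_nat_mult)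
    also have "\<dots> \<le> (real A + 1) * real (d n)" by (intro mult_right_mono) auto
    finally show ?thesis by (simp add: c_def field_simps)
  qed
  have up: "real (d n) \<le> C * real n" if "0 < n" for n
  proof -
    have "real (d n) \<le> real B * real n" using upper[OF that] by (metis of_nat_le_iff of_nat_mult)
    also have "\<dots> \<le> C * real n" unfolding C_def by (intro mult_right_mono) auto
    finally show ?thesis .
  qed
  have "\<forall>\<^sub>F n in sequentially. c * real n \<le> real (d n) \<and> real (d n) \<le> C * real n"
    using eventually_gt_at_top[of 0] by (rule eventually_mono) (simp add: lo up)
  moreover have "0 < c" "c \<le> C" by (auto simp: c_def C_def)
  ultimately show ?thesis by blast
qed

lemma not_linear_growth_if_bounded:
  fixes d :: "nat \<Rightarrow> nat"
  assumes upper: "\<And>n. 0 < n \<Longrightarrow> d n \<le> B"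
  shows "\<not> (\<exists>c C :: real. 0 < c \<and> c \<le> C \<and>
    (\<forall>\<^sub>F n in sequentially. c * real n \<le> real (d n) \<and> real (d n) \<le> C * real n))"
proof
  assume "\<exists>c C :: real. 0 < c \<and> c \<le> C \<and>
    (\<forall>\<^sub>F n in sequentially. c * real n \<le> real (d n) \<and> real (d n) \<le> C * real n)"
  then obtain c :: real where c: "0 < c" and ev: "\<forall>\<^sub>F n in sequentially. c * real n \<le> real (d n)"
    by (auto simp: eventually_conj_iff)
  obtain m where m: "real B / c < real m" using reals_Archimedean2 by blast
  have "\<forall>\<^sub>F n in sequentially. c * real n \<le> real (d n) \<and> Suc m \<le> n"
    using ev eventually_ge_at_top by (rule eventually_conj)
  then obtain n where n: "c * real n \<le> real (d n)" "Suc m \<le> n"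
    using eventually_happens'[OF sequentially_bot] by blast
  have "real B < c * real m" using m c by (simp add: field_simps)
  also have "\<dots> \<le> c * real n" using n(2) c by (intro mult_left_mono) auto
  also have "\<dots> \<le> real B" using n upper[of n] by linarith
  finally show False by simp
qed

locale conjugated_to_jonquieres =
  fixes \<phi> \<psi> \<psi>' :: "poly3^3" and M :: "complex poly^2^2"
  assumes \<phi>: "dominant_self_map \<phi>" and inv: "mutually_inverse \<psi> \<psi>'"
    and J: "jonquieres (compose \<psi> (compose \<phi> \<psi>')) M"
begin

definition conj_iterate :: "nat \<Rightarrow> poly3^3"
  where "conj_iterate n = substitute \<psi> (substitute (iterate \<phi> n) \<psi>')"

lemma dominants: "dominant_self_map \<psi>" "dominant_self_map \<psi>'"
  using inv mutually_inverse_dominant mutually_inverse_sym by blast+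

lemma dominant_conj_iterate: "dominant_self_map (conj_iterate n)"
  unfolding conj_iterate_def
  by (intro dominant_self_map_substitute dominants iterate_dominant \<phi>)

text \<open>
  Inserting \<open>\<psi>' \<circ> \<psi>\<close> between \<open>\<phi>\<close> and its \<open>n\<close>-th iterate splits off the conjugate of \<open>\<phi>\<close>, whose matrix is
  \<open>M\<close>; composition corresponds to the product of matrices.
\<close>

lemma conj_iterate_matpow:
  assumes m: "entries_le m M"
  shows "proj_eq (conj_iterate n) (jonquieres_tuple (n * m) (matpow M n))"
proof (induction n)
  case 0
  have J0: "jonquieres id_map (mat 1)"
    by (simp add: jonquieres_def id_map_simps poly_generators) (simp add: mat_def)
  have "proj_eq (conj_iterate 0) id_map"
    using mutually_inverse_substitute[OF inv]
    by (simp add: conj_iterate_def iterate_0 substitute_id_left)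
  also have "proj_eq id_map (jonquieres_tuple 0 (mat 1))"
    by (rule proj_eq_jonquieres_tuple[OF homogeneous_tuple_id
          dominant_self_map_nonzero[OF dominant_self_map_id] J0])
      (simp add: entries_le_def mat_def)
  finally show ?case by simp
next
  case (Suc n)
  define g where "g = compose \<psi> (compose \<phi> \<psi>')"
  define \<phi>n where "\<phi>n = iterate \<phi> n"
  have det: "det M \<noteq> 0" using J by (simp add: jonquieres_def)
  note dom = dominants \<phi> dominant_conj_iterate
  have dn: "dominant_self_map \<phi>n" unfolding \<phi>n_def by (rule iterate_dominant[OF \<phi>])
  note refl = proj_eq_refl[OF dominant_self_map_nonzero]
  have dg: "dominant_self_map g" unfolding g_def by (intro compose_dominant dom)
  have geq: "proj_eq g (substitute \<psi> (substitute \<phi> \<psi>'))"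
    unfolding g_def
    by (rule proj_eq_trans[OF compose_dominant(2) proj_eq_substitute])
      (intro dom compose_dominant refl)+
  obtain e where e: "homogeneous_tuple e g" using dg by (rule dominant_self_mapE)
  have gM: "proj_eq g (jonquieres_tuple m M)"
    by (rule proj_eq_jonquieres_tuple[OF e dominant_self_map_nonzero[OF dg] _ m])
      (simp add: g_def J)
  have domM: "dominant_self_map (jonquieres_tuple m M)"
    by (rule dominant_self_map_proj_eq[OF gM dg homogeneous_jonquieres_tuple])
  have insert: "proj_eq
      (substitute (substitute \<psi> \<phi>) (substitute (substitute \<psi>' \<psi>) (substitute \<phi>n \<psi>')))
      (substitute (substitute \<psi> \<phi>) (substitute \<phi>n \<psi>'))"
    by (rule cancel_inverse[OF _ _ mutually_inverse_sym[OF inv]])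
      (intro dominant_self_map_substitute dom dn)+
  have "proj_eq (conj_iterate (Suc n)) (substitute \<psi> (substitute (substitute \<phi> \<phi>n) \<psi>'))"
    unfolding conj_iterate_def iterate_Suc \<phi>n_def[symmetric]
    by (intro proj_eq_substitute compose_dominant dominant_self_map_substitute dom dn refl)
  also have "proj_eq \<dots> (substitute (substitute \<psi> (substitute \<phi> \<psi>')) (conj_iterate n))"
    using proj_eq_sym[OF insert] unfolding conj_iterate_def \<phi>n_def[symmetric] substitute_assoc .
  also have "proj_eq \<dots> (substitute (jonquieres_tuple m M) (jonquieres_tuple (n * m) (matpow M n)))"
    by (rule proj_eq_substitute[OF proj_eq_trans[OF proj_eq_sym[OF geq] gM] _ domM Suc.IH])
      (intro dom dominant_self_map_substitute)+
  also have "proj_eq \<dots> (jonquieres_tuple (m + n * m) (M ** matpow M n))"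
    by (rule substitute_jonquieres_tuple[OF m entries_le_matpow[OF m] det])
      (simp add: det_matpow det)
  finally show ?case by simp
qed

lemma jonquieres_conj_iterate: "jonquieres (conj_iterate n) (matpow M n)"
proof -
  obtain m where m: "entries_le m M" using ex_entries_le by blast
  have "det (matpow M n) \<noteq> 0" using J by (simp add: jonquieres_def det_matpow)
  then show ?thesis
    by (rule jonquieres_if_proj_eq[OF conj_iterate_matpow[OF m] _ entries_le_matpow[OF m]])
qed

text \<open>
  The iterate is recovered by composing its conjugate with \<open>\<psi>'\<close> and \<open>\<psi>\<close>, and the conjugate may be
  represented by any matrix proportional to \<open>M\<^sup>n\<close>.
\<close>

lemma map_degree_iterate_le:
  assumes N: "proportional N (matpow M n)" "entries_le e N" and n: "0 < n"
  shows "map_degree (iterate \<phi> n) \<le> map_degree \<psi>' * ((e + 2) * map_degree \<psi>)"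
proof -
  have det: "det N \<noteq> 0"
    using proportional_det[OF N(1)] J by (simp add: jonquieres_def det_matpow)
  obtain k where k: "homogeneous_tuple k (conj_iterate n)"
    using dominant_conj_iterate by (rule dominant_self_mapE)
  have "jonquieres (conj_iterate n) N"
    by (rule jonquieres_proportional[OF jonquieres_conj_iterate proportional_sym[OF N(1)] det])
  then have EN: "proj_eq (conj_iterate n) (jonquieres_tuple e N)"
    using proj_eq_jonquieres_tuple[OF k dominant_self_map_nonzero[OF dominant_conj_iterate]] N(2)
    by blast
  have domN: "dominant_self_map (jonquieres_tuple e N)"
    by (rule dominant_self_map_proj_eq[OF EN dominant_conj_iterate homogeneous_jonquieres_tuple])
  note refl = proj_eq_refl[OF dominant_self_map_nonzero]
  note dom = dominants iterate_dominant[OF \<phi>]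
  obtain l where l: "n = Suc l" using n by (cases n) auto
  define \<phi>n where "\<phi>n = iterate \<phi> n"
  have dn: "dominant_self_map \<phi>n" unfolding \<phi>n_def by (rule dom)
  have "proj_eq (substitute id_map (substitute (substitute \<psi>' \<psi>) \<phi>n)) (substitute id_map \<phi>n)"
    by (rule cancel_inverse[OF dominant_self_map_id dn mutually_inverse_sym[OF inv]])
  then have 1: "proj_eq \<phi>n (substitute (substitute \<psi>' \<psi>) \<phi>n)"
    unfolding substitute_id_left by (rule proj_eq_sym)
  have "proj_eq (substitute (substitute \<psi>' (substitute \<psi> \<phi>n)) (substitute (substitute \<psi>' \<psi>) id_map))
      (substitute (substitute \<psi>' (substitute \<psi> \<phi>n)) id_map)"
    by (rule cancel_inverse[OF _ dominant_self_map_id mutually_inverse_sym[OF inv]])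
      (intro dominant_self_map_substitute dom dn)
  then have 2: "proj_eq (substitute (substitute \<psi>' \<psi>) \<phi>n) (substitute \<psi>' (substitute (conj_iterate n) \<psi>))"
    unfolding substitute_id_right conj_iterate_def \<phi>n_def[symmetric] substitute_assoc
    by (rule proj_eq_sym)
  have 3: "proj_eq (substitute \<psi>' (substitute (conj_iterate n) \<psi>))
      (substitute \<psi>' (substitute (jonquieres_tuple e N) \<psi>))"
    by (intro proj_eq_substitute EN domN dominant_conj_iterate dominant_self_map_substitute dom refl)
  have eq: "proj_eq (iterate \<phi> n) (substitute \<psi>' (substitute (jonquieres_tuple e N) \<psi>))"
    using proj_eq_trans[OF proj_eq_trans[OF 1 2] 3] by (simp only: \<phi>n_def)
  have "homogeneous_tuple (map_degree \<psi>' * ((e + 2) * map_degree \<psi>))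
      (substitute \<psi>' (substitute (jonquieres_tuple e N) \<psi>))"
    by (intro homogeneous_tuple_substitute homogeneous_jonquieres_tuple homogeneous_map_degree dom)
  then show ?thesis
    using map_degree_compose_le[OF \<phi> dom(3)] eq unfolding l iterate_Suc by blast
qed

lemma le_map_degree_iterate:
  assumes "\<nexists>c. (trace M)^2 = smult c (det M)"
  shows "n \<le> 2 * map_degree \<psi> * map_degree \<psi>' * map_degree (iterate \<phi> n)"
proof -
  have h: "homogeneous_tuple (map_degree \<psi> * (map_degree (iterate \<phi> n) * map_degree \<psi>')) (conj_iterate n)"
    unfolding conj_iterate_def
    by (intro homogeneous_tuple_substitute homogeneous_map_degree dominants iterate_dominant \<phi>)
  obtain N where "proportional N (matpow M n)"
    "entries_le (map_degree \<psi> * (map_degree (iterate \<phi> n) * map_degree \<psi>')) N"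
    using jonquieres_reduced_matrix[OF h dominant_self_map_nonzero[OF dominant_conj_iterate]
        jonquieres_conj_iterate] by blast
  from degree_ge_if_index_nonconstant[OF _ assms this] show ?thesis
    using J by (simp add: jonquieres_def mult_ac)
qed

lemma linear_growth_iff: "linear_growth \<phi> \<longleftrightarrow> (\<nexists>c. (trace M)^2 = smult c (det M))"
proof
  obtain m where m: "entries_le m M" using ex_entries_le by blast
  {
    assume "linear_growth \<phi>"
    show "\<nexists>c. (trace M)^2 = smult c (det M)"
    proof
      assume "\<exists>c. (trace M)^2 = smult c (det M)"
      then have "\<exists>N. proportional N (matpow M n) \<and> entries_le m N" for n
        using bounded_if_index_constant[OF _ _ m] J by (auto simp: jonquieres_def)
      then have "map_degree (iterate \<phi> n) \<le> map_degree \<psi>' * ((m + 2) * map_degree \<psi>)" if "0 < n" for n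
        using map_degree_iterate_le[OF _ _ that] by blast
      then show False
        using not_linear_growth_if_bounded[of "\<lambda>n. map_degree (iterate \<phi> n)"] \<open>linear_growth \<phi>\<close>
        unfolding linear_growth_def by blast
    qed
  }
  {
    assume nonconst: "\<nexists>c. (trace M)^2 = smult c (det M)"
    have upper: "map_degree (iterate \<phi> n) \<le> (map_degree \<psi>' * ((m + 2) * map_degree \<psi>)) * n"
      if "0 < n" for n
    proof -
      have "map_degree (iterate \<phi> n) \<le> map_degree \<psi>' * ((n * m + 2) * map_degree \<psi>)"
        by (rule map_degree_iterate_le[OF proportional_refl entries_le_matpow[OF m] that])
      also have "\<dots> \<le> map_degree \<psi>' * ((m + 2) * n * map_degree \<psi>)"
        using that by (intro mult_le_mono le_refl) (simp add: algebra_simps)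
      finally show ?thesis by (simp only: mult_ac)
    qed
    show "linear_growth \<phi>"
      unfolding linear_growth_def
      by (rule linear_growth_if_bounds[OF le_map_degree_iterate[OF nonconst] upper])
  }
qed

end

lemma baum_bott_constant_iff:
  assumes "det M \<noteq> 0"
  shows "baum_bott M \<in> constants \<longleftrightarrow> (\<exists>c. (trace M)^2 = smult c (det M))"
proof -
  have "baum_bott M = to_fract [:c:] \<longleftrightarrow> (trace M)^2 = smult c (det M)" for c
    using assms by (simp add: baum_bott_def to_fract_def eq_fract)
  then show ?thesis by (auto simp: constants_def)
qed

theorem mainTheorem1:
  fixes \<phi> :: "poly3^3" and f :: "poly3^2" and b :: "complex poly fract"
  assumes "\<phi> \<in> Bir"
    and "rational_fibration f"
    and "preserves_fibrewise \<phi> f"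
    and "baum_bott_index \<phi> f b"
  shows "linear_growth \<phi> \<longleftrightarrow> b \<notin> constants"
proof -
  have dom: "dominant_self_map \<phi>"
    using assms(1) mutually_inverse_dominant by (auto simp: Bir_def)
  obtain \<psi> \<psi>' M where inv: "mutually_inverse \<psi> \<psi>'"
    and J: "jonquieres (compose \<psi> (compose \<phi> \<psi>')) M" and b: "b = baum_bott M"
    using assms(4) unfolding baum_bott_index_def by blast
  interpret conjugated_to_jonquieres \<phi> \<psi> \<psi>' M
    using dom inv J by unfold_locales
  have "det M \<noteq> 0" using J by (simp add: jonquieres_def)
  then show ?thesis
    using linear_growth_iff unfolding b baum_bott_constant_iff[OF \<open>det M \<noteq> 0\<close>] by blast
qed

end
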